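(* Let $N\ge 1$ be an integer (polynomial degree). Consider the linear advection equation $\partial_t u+\partial_x u=0$ for $x\in(0,2\pi)$, $t>0$, with periodic boundary conditions and initial datum $u(x,0)=e^{\mathrm{i}\kappa x}$, $\kappa\in\mathbb{N}$. Consider on $[0,2\pi]$ a uniform Eulerian grid of an even number $N_e>0$ of elements of size $\Delta x=2\pi/N_e$, with time step $\Delta t>0$, and replace every other interface by a hole-like sliver element of width $2\delta\Delta x$, $\delta\in(0,1)$. Consider the Rusanov-type numerical flux. Then the implicit ADER-DG method of degree $N$ with slivers (described in the context), applied to this problem, is $L^2$ stable provided $$\delta\le\frac12\min\left\{\frac{\Delta t}{\Delta x},\,1\right\}.$$ That is, under this condition every sequence of discrete solutions $(u^n)_{n\ge0}$ generated by the method satisfies $\|u^{n}\|_{L^2(0,2\pi)}\le\|u^0\|_{L^2(0,2\pi)}$ for all $n\ge 0$.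
   Context: **Geometry.** $x_{i+1/2}=i\,\Delta x$ for $i=0,\dots,N_e$, $\Omega_i=[x_{i-1/2},x_{i+1/2}]$ for $i=1,\dots,N_e$, element indices modulo $N_e$ (periodicity), $t^n=n\Delta t$. For every even $i\in\{2,4,\dots,N_e\}$ and every $n\ge 0$, the vertical spacetime interface $\{x_{i-1/2}\}\times[t^n,t^{n+1}]$ is replaced by the sliver $S_{i-1/2}^n$, the closed quadrilateral with vertices $$(x_{i-1/2},t^n),\quad (x_{i-1/2}+\delta\Delta x,\,t^n+\tfrac{\Delta t}2),\quad (x_{i-1/2},t^{n+1}),\quad (x_{i-1/2}-\delta\Delta x,\,t^n+\tfrac{\Delta t}2).$$ The control volume $C_i^n$ is the closure of $\big(\Omega_i\times[t^n,t^{n+1}]\big)$ minus the (unique) sliver meeting it in a set of positive measure. The boundary of $S_{i-1/2}^n$ is $\Sigma_{i-1/2}^{n,-}\cup\Sigma_{i-1/2}^{n,+}$, where $\Sigma_{i-1/2}^{n,-}$ (the two left sides) is shared with $C_{i-1}^n$ and $\Sigma_{i-1/2}^{n,+}$ (the two right sides) is shared with $C_i^n$. The remaining interfaces, at $x_{i+1/2}$ with $i$ even (including the periodic boundary $x_{1/2}\equiv x_{N_e+1/2}$), stay vertical segments $\Sigma_{i+1/2}^n=\{x_{i+1/2}\}\times[t^n,t^{n+1}]$ shared by $C_i^n$ and $C_{i+1}^n$. Thus the domain consists of periodic triplets $(C_{i-1}^n,S_{i-1/2}^n,C_i^n)$, $i$ even. **Discrete spaces.** At time $t^n$ the discrete solution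 $u^n$ is given on each $\Omega_i$ by a polynomial $u_i^n$ in $x$ of degree at most $N$ (complex coefficients); $u^0$ is the elementwise $L^2$ projection of the initial datum. On every control volume or sliver $K$ one uses the space $\mathcal{P}_N(K)$ of polynomials in $(x,t)$ of total degree at most $N$; the approximants are $q_i^n\in\mathcal{P}_N(C_i^n)$ and $q_{i-1/2}^n\in\mathcal{P}_N(S_{i-1/2}^n)$ ($i$ even), with complex coefficients. **Rusanov-type ALE flux.** For the flux function $f(q)=q$, interior value $q^-$, exterior value $q^+$ and outward unit normal $\hat n=(\hat n_x,\hat n_t)$ to a lateral face, $$\mathcal F(q^-,q^+,\hat n)=\tfrac12(q^++q^-)\hat n_x+\tfrac12(q^++q^-)\hat n_t-\tfrac12 s_{\max}(q^+-q^-),\qquad s_{\max}=|1-v|\,|\hat n_x|,$$ where $v=-\hat n_t/\hat n_x$ is the local grid velocity; hence $s_{\max}=|\hat n_x+\hat n_t|$. **Implicit ADER-DG step with slivers.** Given $\{u_i^n\}_i$, find simultaneously all $q_i^n$ and $q_{i-1/2}^n$ such that: (1) for every $i=1,\dots,N_e$ and every $\vartheta\in\mathcal{P}_N(C_i^n)$, $$\int_{\Omega_i}\vartheta(x,t^{n+1})q_i^n(x,t^{n+1})\,dx-\int_{C_i^n}(\partial_t\vartheta+\partial_x\vartheta)q_i^n\,dx\,dt+\int_{\Sigma_L}\vartheta\,\mathcal F(q_i^n,q_L,\hat n)\,ds+\int_{\Sigma_R}\vartheta\,\mathcal F(q_i^n,q_R,\hat n)\,ds=\int_{\Omega_i}\vartheta(x,t^n)u_i^n(x)\,dx,$$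 where $\hat n$ is the outward unit normal to $\partial C_i^n$, $\Sigma_L,\Sigma_R$ are the left and right lateral parts of $\partial C_i^n$, and $q_L,q_R$ are the approximants on the neighbours across them. For $i$ even: $\Sigma_L=\Sigma_{i-1/2}^{n,+}$, $q_L=q_{i-1/2}^n$, $\Sigma_R=\Sigma_{i+1/2}^n$, $q_R=q_{i+1}^n$. For $i$ odd: $\Sigma_L=\Sigma_{i-1/2}^n$, $q_L=q_{i-1}^n$, $\Sigma_R=\Sigma_{i+1/2}^{n,-}$, $q_R=q_{i+1/2}^n$. Across the boundary $x_{1/2}\equiv x_{N_e+1/2}$ neighbours are taken periodically. (2) for every even $i$ and every $\vartheta\in\mathcal{P}_N(S_{i-1/2}^n)$, $$\int_{\Sigma_{i-1/2}^{n,-}}\vartheta\,\mathcal F(q_{i-1/2}^n,q_{i-1}^n,\hat n)\,ds+\int_{\Sigma_{i-1/2}^{n,+}}\vartheta\,\mathcal F(q_{i-1/2}^n,q_i^n,\hat n)\,ds=\int_{S_{i-1/2}^n}(\partial_t\vartheta+\partial_x\vartheta)q_{i-1/2}^n\,dx\,dt,$$ where $\hat n$ is the outward unit normal to $\partial S_{i-1/2}^n$. Then $u_i^{n+1}$ is the $L^2(\Omega_i)$-projection of $q_i^n(\cdot,t^{n+1})$ onto polynomials of degree at most $N$, i.e. $u_i^{n+1}=q_i^n(\cdot,t^{n+1})$. *)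

theory Defs
  imports "HOL-Analysis.Analysis" "HOL-Computational_Algebra.Polynomial"
begin

section \<open>Geometry\<close>

text \<open>Points of the spacetime plane are pairs \<open>(x, t)\<close>.  Elements are numbered \<open>1, \<dots>, Ne\<close>, with
  \<open>\<Omega>\<^sub>i = [(i - 1) \<Delta>x, i \<Delta>x]\<close>; the sliver on the left interface \<open>x = (i - 1) \<Delta>x\<close> of an even
  element \<open>i\<close> carries the index \<open>i\<close>.\<close>

definition mesh :: "nat \<Rightarrow> real" where
  "mesh Ne = 2 * pi / real Ne"

definition xleft :: "real \<Rightarrow> nat \<Rightarrow> real" where
  "xleft \<Delta>x i = (real i - 1) * \<Delta>x"

definition xright :: "real \<Rightarrow> nat \<Rightarrow> real" where
  "xright \<Delta>x i = real i * \<Delta>x"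

definition tlev :: "real \<Rightarrow> nat \<Rightarrow> real" where
  "tlev \<Delta>t n = real n * \<Delta>t"

definition sliver_bot :: "real \<Rightarrow> real \<Rightarrow> nat \<Rightarrow> nat \<Rightarrow> real \<times> real" where
  "sliver_bot \<Delta>x \<Delta>t n i = (xleft \<Delta>x i, tlev \<Delta>t n)"

definition sliver_right :: "real \<Rightarrow> real \<Rightarrow> real \<Rightarrow> nat \<Rightarrow> nat \<Rightarrow> real \<times> real" where
  "sliver_right \<Delta>x \<Delta>t \<delta> n i = (xleft \<Delta>x i + \<delta> * \<Delta>x, tlev \<Delta>t n + \<Delta>t / 2)"

definition sliver_top :: "real \<Rightarrow> real \<Rightarrow> nat \<Rightarrow> nat \<Rightarrow> real \<times> real" where
  "sliver_top \<Delta>x \<Delta>t n i = (xleft \<Delta>x i, tlev \<Delta>t (Suc n))"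

definition sliver_left :: "real \<Rightarrow> real \<Rightarrow> real \<Rightarrow> nat \<Rightarrow> nat \<Rightarrow> real \<times> real" where
  "sliver_left \<Delta>x \<Delta>t \<delta> n i = (xleft \<Delta>x i - \<delta> * \<Delta>x, tlev \<Delta>t n + \<Delta>t / 2)"

definition sliver :: "real \<Rightarrow> real \<Rightarrow> real \<Rightarrow> nat \<Rightarrow> nat \<Rightarrow> (real \<times> real) set" where
  "sliver \<Delta>x \<Delta>t \<delta> n i = convex hull
     {sliver_bot \<Delta>x \<Delta>t n i, sliver_right \<Delta>x \<Delta>t \<delta> n i,
      sliver_top \<Delta>x \<Delta>t n i, sliver_left \<Delta>x \<Delta>t \<delta> n i}"

text \<open>The only sliver overlapping \<open>\<Omega>\<^sub>i \<times> [t\<^sup>n, t\<^sup>n\<^sup>+\<^sup>1]\<close> sits on its left interface if \<open>i\<close> is even and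
  on its right interface if \<open>i\<close> is odd.\<close>

definition sliver_index :: "nat \<Rightarrow> nat" where
  "sliver_index i = (if even i then i else Suc i)"

lemma sliver_strip:
  assumes "\<Delta>x > 0" "\<delta> > 0" "p \<in> sliver \<Delta>x \<Delta>t \<delta> n i"
  shows "\<bar>fst p - xleft \<Delta>x i\<bar> \<le> \<delta> * \<Delta>x"
proof -
  let ?H = "{xleft \<Delta>x i - \<delta> * \<Delta>x..xleft \<Delta>x i + \<delta> * \<Delta>x} \<times> (UNIV :: real set)"
  have "0 < \<delta> * \<Delta>x" using assms by simp
  then have "{sliver_bot \<Delta>x \<Delta>t n i, sliver_right \<Delta>x \<Delta>t \<delta> n i,
      sliver_top \<Delta>x \<Delta>t n i, sliver_left \<Delta>x \<Delta>t \<delta> n i} \<subseteq> ?H"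
    by (auto simp: sliver_bot_def sliver_right_def sliver_top_def sliver_left_def)
  then have "sliver \<Delta>x \<Delta>t \<delta> n i \<subseteq> ?H"
    unfolding sliver_def by (rule hull_minimal) (simp add: convex_Times)
  then show ?thesis using assms(3) by (auto simp: abs_le_iff)
qed

lemma sliver_disjoint_other_columns:
  assumes "\<Delta>x > 0" "0 < \<delta>" "\<delta> < 1" "even j" "j \<noteq> sliver_index i"
  shows "sliver \<Delta>x \<Delta>t \<delta> n j \<inter> ({xleft \<Delta>x i..xright \<Delta>x i} \<times> UNIV) = {}"
proof -
  have "False" if p: "p \<in> sliver \<Delta>x \<Delta>t \<delta> n j" "xleft \<Delta>x i \<le> fst p" "fst p \<le> xright \<Delta>x i" for p
  proof -
    define y where "y = fst p"
    have y: "\<bar>y - (real j - 1) * \<Delta>x\<bar> \<le> \<delta> * \<Delta>x" "(real i - 1) * \<Delta>x \<le> y" "y \<le> real i * \<Delta>x"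
      using sliver_strip[OF assms(1,2) p(1)] p(2,3) by (simp_all add: xleft_def xright_def y_def)
    have "j \<ge> i + 2 \<or> j + 1 \<le> i"
      using assms(4,5) by (auto simp: sliver_index_def split: if_splits; presburger)
    then show False
    proof
      assume "j \<ge> i + 2"
      then have "(real i + \<delta>) * \<Delta>x < (real j - 1) * \<Delta>x"
        using assms by (intro mult_strict_right_mono) auto
      with y show False by (simp add: abs_le_iff algebra_simps)
    next
      assume "j + 1 \<le> i"
      then have "(real j - 1 + \<delta>) * \<Delta>x < (real i - 1) * \<Delta>x"
        using assms by (intro mult_strict_right_mono) auto
      with y show False by (simp add: abs_le_iff algebra_simps)
    qed
  qed
  then show ?thesis by auto
qed

definition control_volume :: "real \<Rightarrow> real \<Rightarrow> real \<Rightarrow> nat \<Rightarrow> nat \<Rightarrow> (real \<times> real) set" where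
  "control_volume \<Delta>x \<Delta>t \<delta> n i = closure
     ({xleft \<Delta>x i..xright \<Delta>x i} \<times> {tlev \<Delta>t n..tlev \<Delta>t (Suc n)}
        - sliver \<Delta>x \<Delta>t \<delta> n (sliver_index i))"


section \<open>Faces, normals and integrals along faces\<close>

text \<open>A face is a list of directed segments.  Every boundary is traversed counterclockwise, so that
  the outward unit normal lies to the right of the direction of travel.\<close>

type_synonym face = "((real \<times> real) \<times> (real \<times> real)) list"

definition seg_normal :: "real \<times> real \<Rightarrow> real \<times> real \<Rightarrow> real \<times> real" where
  "seg_normal a b = (snd b - snd a, fst a - fst b) /\<^sub>R dist a b"

definition seg_integral ::
    "real \<times> real \<Rightarrow> real \<times> real \<Rightarrow> (real \<times> real \<Rightarrow> complex) \<Rightarrow> complex" where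
  "seg_integral a b f = dist a b *\<^sub>R (LINT s:{0..1}|lborel. f (linepath a b s))"

definition reverse_face :: "face \<Rightarrow> face" where
  "reverse_face F = map prod.swap (rev F)"

definition sliver_face_left :: "real \<Rightarrow> real \<Rightarrow> real \<Rightarrow> nat \<Rightarrow> nat \<Rightarrow> face" where
  "sliver_face_left \<Delta>x \<Delta>t \<delta> n i =
     [(sliver_top \<Delta>x \<Delta>t n i, sliver_left \<Delta>x \<Delta>t \<delta> n i),
      (sliver_left \<Delta>x \<Delta>t \<delta> n i, sliver_bot \<Delta>x \<Delta>t n i)]"

definition sliver_face_right :: "real \<Rightarrow> real \<Rightarrow> real \<Rightarrow> nat \<Rightarrow> nat \<Rightarrow> face" where
  "sliver_face_right \<Delta>x \<Delta>t \<delta> n i =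
     [(sliver_bot \<Delta>x \<Delta>t n i, sliver_right \<Delta>x \<Delta>t \<delta> n i),
      (sliver_right \<Delta>x \<Delta>t \<delta> n i, sliver_top \<Delta>x \<Delta>t n i)]"

definition cv_face_left :: "real \<Rightarrow> real \<Rightarrow> real \<Rightarrow> nat \<Rightarrow> nat \<Rightarrow> face" where
  "cv_face_left \<Delta>x \<Delta>t \<delta> n i =
     (if even i then reverse_face (sliver_face_right \<Delta>x \<Delta>t \<delta> n i)
      else [((xleft \<Delta>x i, tlev \<Delta>t (Suc n)), (xleft \<Delta>x i, tlev \<Delta>t n))])"

definition cv_face_right :: "real \<Rightarrow> real \<Rightarrow> real \<Rightarrow> nat \<Rightarrow> nat \<Rightarrow> face" where
  "cv_face_right \<Delta>x \<Delta>t \<delta> n i =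
     (if even i then [((xright \<Delta>x i, tlev \<Delta>t n), (xright \<Delta>x i, tlev \<Delta>t (Suc n)))]
      else reverse_face (sliver_face_left \<Delta>x \<Delta>t \<delta> n (Suc i)))"

lemma norm_seg_normal: "a \<noteq> b \<Longrightarrow> norm (seg_normal a b) = 1"
proof -
  assume "a \<noteq> b"
  moreover have "norm (snd b - snd a, fst a - fst b) = dist a b"
    by (cases a; cases b) (simp add: norm_Pair dist_Pair_Pair dist_real_def power2_commute add.commute)
  ultimately show ?thesis unfolding seg_normal_def norm_scaleR by simp
qed

lemma seg_normal_orthogonal: "seg_normal a b \<bullet> (b - a) = 0"
  by (cases a; cases b) (simp add: seg_normal_def inner_Pair algebra_simps)

lemma seg_normal_swap: "seg_normal b a = - seg_normal a b"
  by (simp add: seg_normal_def dist_commute prod_eq_iff algebra_simps)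

lemma seg_normal_sliver_outward:
  assumes "\<Delta>x > 0" "\<Delta>t > 0" "\<delta> > 0"
    and "(a, b) \<in> set (sliver_face_left \<Delta>x \<Delta>t \<delta> n i @ sliver_face_right \<Delta>x \<Delta>t \<delta> n i)"
    and "p \<in> sliver \<Delta>x \<Delta>t \<delta> n i"
  shows "seg_normal a b \<bullet> (p - a) \<le> 0"
proof -
  let ?H = "{p. seg_normal a b \<bullet> p \<le> seg_normal a b \<bullet> a}"
  have nn: "0 \<le> \<delta> * (\<Delta>t * \<Delta>x)" using assms by simp
  have scal: "r * inverse (dist a b) \<le> s * inverse (dist a b)" if "r \<le> s" for r s :: real
    by (rule mult_right_mono) (use that in auto)
  have iff: "q \<in> ?H" if "(snd b - snd a) * (fst q - fst a) + (fst a - fst b) * (snd q - snd a) \<le> 0"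
    for q
  proof -
    have "seg_normal a b \<bullet> (q - a) =
        inverse (dist a b) * ((snd b - snd a) * (fst q - fst a) + (fst a - fst b) * (snd q - snd a))"
      by (cases q; cases a; cases b) (simp add: seg_normal_def inner_Pair algebra_simps)
    also have "\<dots> \<le> 0"
      using that by (intro mult_nonneg_nonpos) auto
    finally show ?thesis by (simp add: inner_diff_right)
  qed
  have "{sliver_bot \<Delta>x \<Delta>t n i, sliver_right \<Delta>x \<Delta>t \<delta> n i,
      sliver_top \<Delta>x \<Delta>t n i, sliver_left \<Delta>x \<Delta>t \<delta> n i} \<subseteq> ?H"
    using assms(4) nn
    apply (intro subsetI iff)
    apply (auto simp: sliver_face_left_def sliver_face_right_def sliver_bot_def sliver_right_def
        sliver_top_def sliver_left_def tlev_def algebra_simps)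
    done
  then have "sliver \<Delta>x \<Delta>t \<delta> n i \<subseteq> ?H"
    unfolding sliver_def by (rule hull_minimal) (simp add: convex_halfspace_le)
  then show ?thesis using assms(5) by (auto simp: inner_diff_right)
qed


section \<open>Discrete spaces\<close>

text \<open>Every control volume and every sliver has nonempty interior, so a polynomial on it is
  identified with the polynomial function on the whole plane.\<close>

definition poly_space :: "nat \<Rightarrow> (real \<times> real \<Rightarrow> complex) set" where
  "poly_space N = {p. \<exists>c :: nat \<Rightarrow> nat \<Rightarrow> complex. \<forall>x t.
     p (x, t) = (\<Sum>a\<le>N. \<Sum>b\<le>N - a. c a b * of_real x ^ a * of_real t ^ b)}"

definition partial_x :: "(real \<times> real \<Rightarrow> complex) \<Rightarrow> real \<times> real \<Rightarrow> complex" where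
  "partial_x f p = vector_derivative (\<lambda>x. f (x, snd p)) (at (fst p))"

definition partial_t :: "(real \<times> real \<Rightarrow> complex) \<Rightarrow> real \<times> real \<Rightarrow> complex" where
  "partial_t f p = vector_derivative (\<lambda>t. f (fst p, t)) (at (snd p))"

definition is_L2_projection ::
    "nat \<Rightarrow> real \<Rightarrow> real \<Rightarrow> (real \<Rightarrow> complex) \<Rightarrow> complex poly \<Rightarrow> bool" where
  "is_L2_projection N a b g p \<longleftrightarrow> degree p \<le> N \<and>
     (\<forall>w. degree w \<le> N \<longrightarrow>
        (LINT x:{a..b}|lborel. (g x - poly p (of_real x)) * cnj (poly w (of_real x))) = 0)"

text \<open>The piecewise polynomial function on \<open>(0, 2\<pi>)\<close>: \<open>x\<close> lies in element number
  \<open>\<lceil>x / \<Delta>x\<rceil>\<close>, where the value at an interface is taken from the left.\<close>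

definition discrete_fun :: "real \<Rightarrow> (nat \<Rightarrow> complex poly) \<Rightarrow> real \<Rightarrow> complex" where
  "discrete_fun \<Delta>x U x = poly (U (nat \<lceil>x / \<Delta>x\<rceil>)) (of_real x)"

definition L2_norm_on :: "real \<Rightarrow> real \<Rightarrow> (real \<Rightarrow> complex) \<Rightarrow> real" where
  "L2_norm_on a b f = sqrt (LINT x:{a<..<b}|lborel. (cmod (f x))\<^sup>2)"


section \<open>The implicit ADER-DG scheme with slivers\<close>

definition rusanov_flux :: "complex \<Rightarrow> complex \<Rightarrow> real \<times> real \<Rightarrow> complex" where
  "rusanov_flux qm qp \<nu> =
     (let nx = fst \<nu>; nt = snd \<nu>; v = - nt / nx; smax = \<bar>1 - v\<bar> * \<bar>nx\<bar>
      in 1 / 2 * (qp + qm) * of_real nx + 1 / 2 * (qp + qm) * of_real nt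
           - 1 / 2 * of_real smax * (qp - qm))"

definition face_term ::
    "(real \<times> real \<Rightarrow> complex) \<Rightarrow> (real \<times> real \<Rightarrow> complex) \<Rightarrow> (real \<times> real \<Rightarrow> complex) \<Rightarrow>
     face \<Rightarrow> complex" where
  "face_term \<theta> qin qout F =
     (\<Sum>(a, b)\<leftarrow>F. seg_integral a b (\<lambda>p. \<theta> p * rusanov_flux (qin p) (qout p) (seg_normal a b)))"

text \<open>\<open>q i\<close> is the approximant on the control volume of element \<open>i\<close>, and \<open>qs i\<close> (\<open>i\<close> even) the one on
  the sliver with index \<open>i\<close>.  The neighbour across the periodic boundary lives at the other end of
  the domain, whence the shifts of \<open>x\<close> by \<open>2\<pi>\<close>.\<close>

definition left_neighbour ::
    "nat \<Rightarrow> (nat \<Rightarrow> real \<times> real \<Rightarrow> complex) \<Rightarrow> (nat \<Rightarrow> real \<times> real \<Rightarrow> complex) \<Rightarrow> nat \<Rightarrow>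
     real \<times> real \<Rightarrow> complex" where
  "left_neighbour Ne q qs i =
     (if even i then qs i
      else if i = 1 then (\<lambda>(x, t). q Ne (x + 2 * pi, t))
      else q (i - 1))"

definition right_neighbour ::
    "nat \<Rightarrow> (nat \<Rightarrow> real \<times> real \<Rightarrow> complex) \<Rightarrow> (nat \<Rightarrow> real \<times> real \<Rightarrow> complex) \<Rightarrow> nat \<Rightarrow>
     real \<times> real \<Rightarrow> complex" where
  "right_neighbour Ne q qs i =
     (if odd i then qs (i + 1)
      else if i = Ne then (\<lambda>(x, t). q 1 (x - 2 * pi, t))
      else q (i + 1))"

definition control_volume_eq ::
    "nat \<Rightarrow> nat \<Rightarrow> real \<Rightarrow> real \<Rightarrow> nat \<Rightarrow> (nat \<Rightarrow> complex poly) \<Rightarrow>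
     (nat \<Rightarrow> real \<times> real \<Rightarrow> complex) \<Rightarrow> (nat \<Rightarrow> real \<times> real \<Rightarrow> complex) \<Rightarrow> nat \<Rightarrow> bool" where
  "control_volume_eq N Ne \<Delta>t \<delta> n U q qs i \<longleftrightarrow>
     (let \<Delta>x = mesh Ne; \<Omega> = {xleft \<Delta>x i..xright \<Delta>x i} in
      \<forall>\<theta>\<in>poly_space N.
        (LINT x:\<Omega>|lborel. \<theta> (x, tlev \<Delta>t (Suc n)) * q i (x, tlev \<Delta>t (Suc n)))
        - (LINT p:control_volume \<Delta>x \<Delta>t \<delta> n i|lborel. (partial_t \<theta> p + partial_x \<theta> p) * q i p)
        + face_term \<theta> (q i) (left_neighbour Ne q qs i) (cv_face_left \<Delta>x \<Delta>t \<delta> n i)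
        + face_term \<theta> (q i) (right_neighbour Ne q qs i) (cv_face_right \<Delta>x \<Delta>t \<delta> n i)
        = (LINT x:\<Omega>|lborel. \<theta> (x, tlev \<Delta>t n) * poly (U i) (of_real x)))"

definition sliver_eq ::
    "nat \<Rightarrow> nat \<Rightarrow> real \<Rightarrow> real \<Rightarrow> nat \<Rightarrow>
     (nat \<Rightarrow> real \<times> real \<Rightarrow> complex) \<Rightarrow> (nat \<Rightarrow> real \<times> real \<Rightarrow> complex) \<Rightarrow> nat \<Rightarrow> bool" where
  "sliver_eq N Ne \<Delta>t \<delta> n q qs i \<longleftrightarrow>
     (let \<Delta>x = mesh Ne in
      \<forall>\<theta>\<in>poly_space N.
        face_term \<theta> (qs i) (q (i - 1)) (sliver_face_left \<Delta>x \<Delta>t \<delta> n i)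
        + face_term \<theta> (qs i) (q i) (sliver_face_right \<Delta>x \<Delta>t \<delta> n i)
        = (LINT p:sliver \<Delta>x \<Delta>t \<delta> n i|lborel. (partial_t \<theta> p + partial_x \<theta> p) * qs i p))"

definition ader_dg_step ::
    "nat \<Rightarrow> nat \<Rightarrow> real \<Rightarrow> real \<Rightarrow> nat \<Rightarrow> (nat \<Rightarrow> complex poly) \<Rightarrow> (nat \<Rightarrow> complex poly) \<Rightarrow> bool" where
  "ader_dg_step N Ne \<Delta>t \<delta> n U U' \<longleftrightarrow>
     (\<exists>q qs.
        (\<forall>i\<in>{1..Ne}. q i \<in> poly_space N \<and> control_volume_eq N Ne \<Delta>t \<delta> n U q qs i) \<and>
        (\<forall>i\<in>{1..Ne}. even i \<longrightarrow> qs i \<in> poly_space N \<and> sliver_eq N Ne \<Delta>t \<delta> n q qs i) \<and>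
        (\<forall>i\<in>{1..Ne}. is_L2_projection N (xleft (mesh Ne) i) (xright (mesh Ne) i)
           (\<lambda>x. q i (x, tlev \<Delta>t (Suc n))) (U' i)))"

text \<open>\<open>u n i\<close> is the polynomial of the discrete solution at time level \<open>n\<close> on element \<open>i\<close>.\<close>

definition ader_dg_solution ::
    "nat \<Rightarrow> nat \<Rightarrow> real \<Rightarrow> real \<Rightarrow> (real \<Rightarrow> complex) \<Rightarrow> (nat \<Rightarrow> nat \<Rightarrow> complex poly) \<Rightarrow> bool" where
  "ader_dg_solution N Ne \<Delta>t \<delta> u0 u \<longleftrightarrow>
     (\<forall>i\<in>{1..Ne}. is_L2_projection N (xleft (mesh Ne) i) (xright (mesh Ne) i) u0 (u 0 i)) \<and>
     (\<forall>n. ader_dg_step N Ne \<Delta>t \<delta> n (u n) (u (Suc n)))"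

end

theory Submission
  imports Defs
begin

text \<open>Test each cell equation with the conjugate of its own approximant \<open>q\<close> and take real parts.  By
  the divergence theorem the volume integral becomes half the boundary flux of \<open>|q|\<^sup>2\<close>, so that half
  of the energy at the new level, plus half of that at the old level, plus the losses through the
  lateral faces equals the real part of the integral of \<open>cnj q * u\<close> at the old level, which is
  absorbed by Young's inequality.  A sliver has no horizontal sides, so its losses add up to zero.
  Summed over the two sides of a face, the transport parts of the flux cancel and the upwind part
  leaves half the integral of \<open>|n\<^sub>x + n\<^sub>t| |q\<^sup>+ - q\<^sup>-|\<^sup>2\<close>.  Summing over all cells and slivers, the
  energy cannot grow, and the final projection does not increase it.\<close>

section \<open>Polynomial functions of two real variables\<close>

text \<open>The weak form multiplies its factors without conjugation, so a complex approximant has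
  to be tested with \<open>cnj q\<close>; this is an admissible test function because x and t are
  real. The product \<open>transport (cnj q) * q\<close> is not itself a total derivative, but its
  real part is half of \<open>transport\<close> of |q|^2. This is the source of the factors 1/2: the
  half left over from the old-level energy of q is exactly the share that Young's inequality spends,
  so q at the old level drops out of the balance. The geometric obstacle is the divergence theorem
  on sets given as a convex hull or as the closure of a non-convex difference. Up to null lines,
  each of them is a pair of trapezoids stacked at the half time level. There every horizontal slice
  is an interval whose ends move affinely in time, and Fubini together with the one-dimensional
  fundamental theorem is enough.\<close>

inductive_set bipoly :: "(real \<times> real \<Rightarrow> complex) set" where
  bipoly_monom: "(\<lambda>z. c * of_real (fst z) ^ a * of_real (snd z) ^ b) \<in> bipoly"
| bipoly_add: "p \<in> bipoly \<Longrightarrow> q \<in> bipoly \<Longrightarrow> (\<lambda>z. p z + q z) \<in> bipoly"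

lemma bipoly_sum: "(\<And>i. i \<in> I \<Longrightarrow> f i \<in> bipoly) \<Longrightarrow> (\<lambda>z. \<Sum>i\<in>I. f i z) \<in> bipoly"
proof (induction I rule: infinite_finite_induct)
  case (insert i I)
  then show ?case using bipoly_add[of "f i" "\<lambda>z. \<Sum>i\<in>I. f i z"] by simp
qed (use bipoly_monom[of 0 0 0] in simp_all)

text \<open>Products and antiderivatives leave \<open>poly_space N\<close>. Without the degree
  bound, all calculus facts follow by induction over monomials and sums.\<close>

lemma poly_space_imp_bipoly: "p \<in> poly_space N \<Longrightarrow> p \<in> bipoly"
proof -
  assume "p \<in> poly_space N"
  then obtain c where c: "\<And>x t. p (x, t) = (\<Sum>a\<le>N. \<Sum>b\<le>N - a. c a b * of_real x ^ a * of_real t ^ b)"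
    unfolding poly_space_def by blast
  have "p = (\<lambda>z. \<Sum>a\<le>N. \<Sum>b\<le>N - a. c a b * of_real (fst z) ^ a * of_real (snd z) ^ b)"
    using c by (auto simp: fun_eq_iff)
  moreover have "\<dots> \<in> bipoly"
    by (intro bipoly_sum bipoly_monom)
  ultimately show ?thesis by simp
qed

lemma poly_space_cnj: "p \<in> poly_space N \<Longrightarrow> (\<lambda>z. cnj (p z)) \<in> poly_space N"
proof -
  assume "p \<in> poly_space N"
  then obtain c where c: "\<And>x t. p (x, t) = (\<Sum>a\<le>N. \<Sum>b\<le>N - a. c a b * of_real x ^ a * of_real t ^ b)"
    unfolding poly_space_def by blast
  show ?thesis
    unfolding poly_space_def
    by (rule CollectI, rule exI[of _ "\<lambda>a b. cnj (c a b)"]) (simp add: c)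
qed

lemma bipoly_cnj: "p \<in> bipoly \<Longrightarrow> (\<lambda>z. cnj (p z)) \<in> bipoly"
proof (induction rule: bipoly.induct)
  case (bipoly_monom c a b)
  then show ?case using bipoly.bipoly_monom[of "cnj c" a b] by simp
qed (use bipoly_add in simp)

lemma bipoly_mult:
  assumes "p \<in> bipoly" "q \<in> bipoly"
  shows "(\<lambda>z. p z * q z) \<in> bipoly"
  using assms
proof (induction arbitrary: q rule: bipoly.induct)
  case (bipoly_monom c a b)
  from bipoly_monom show ?case
  proof (induction rule: bipoly.induct)
    case (bipoly_monom c' a' b')
    show ?case using bipoly.bipoly_monom[of "c * c'" "a + a'" "b + b'"]
      by (simp add: power_add mult_ac)
  next
    case (bipoly_add p q)
    then show ?case using bipoly.bipoly_add[OF bipoly_add.IH] by (simp add: distrib_left)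
  qed
next
  case (bipoly_add p p')
  then show ?case using bipoly.bipoly_add[OF bipoly_add.IH] by (simp add: distrib_right)
qed

lemma continuous_on_bipoly:
  assumes "p \<in> bipoly" "continuous_on S f"
  shows "continuous_on S (\<lambda>s. p (f s))"
  using assms(1) by induction (intro continuous_intros assms(2) | assumption)+

lemma differentiable_bipoly:
  assumes "p \<in> bipoly"
  shows "(\<lambda>x. p (x, t)) differentiable (at x)" "(\<lambda>t. p (x, t)) differentiable (at t)"
proof -
  show "(\<lambda>x. p (x, t)) differentiable (at x)"
    using assms
  proof induction
    case (bipoly_monom c a b)
    have "((\<lambda>x. c * of_real x ^ a * of_real t ^ b) has_vector_derivative
        c * (of_nat a * of_real x ^ (a - 1)) * of_real t ^ b) (at x)"
      by (rule has_vector_derivative_real_field) (auto intro!: derivative_eq_intros)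
    then show ?case by (auto intro: differentiableI_vector)
  qed simp
  show "(\<lambda>t. p (x, t)) differentiable (at t)"
    using assms
  proof induction
    case (bipoly_monom c a b)
    have "((\<lambda>t. c * of_real x ^ a * of_real t ^ b) has_vector_derivative
        c * of_real x ^ a * (of_nat b * of_real t ^ (b - 1))) (at t)"
      by (rule has_vector_derivative_real_field) (auto intro!: derivative_eq_intros)
    then show ?case by (auto intro: differentiableI_vector)
  qed simp
qed

lemma has_vector_derivative_bipoly:
  assumes "p \<in> bipoly"
  shows "((\<lambda>x. p (x, t)) has_vector_derivative partial_x p (x, t)) (at x)"
    and "((\<lambda>t. p (x, t)) has_vector_derivative partial_t p (x, t)) (at t)"
  using differentiable_bipoly[OF assms]
  by (simp_all add: partial_x_def partial_t_def vector_derivative_works)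

lemma partial_unique:
  "(\<And>x t. ((\<lambda>x. p (x, t)) has_vector_derivative f (x, t)) (at x)) \<Longrightarrow> partial_x p = f"
  "(\<And>x t. ((\<lambda>t. p (x, t)) has_vector_derivative f (x, t)) (at t)) \<Longrightarrow> partial_t p = f"
  by (auto simp: partial_x_def partial_t_def fun_eq_iff intro!: vector_derivative_at)

lemma partial_monom:
  "partial_x (\<lambda>z. c * of_real (fst z) ^ a * of_real (snd z) ^ b) =
    (\<lambda>z. (c * of_nat a) * of_real (fst z) ^ (a - 1) * of_real (snd z) ^ b)"
  "partial_t (\<lambda>z. c * of_real (fst z) ^ a * of_real (snd z) ^ b) =
    (\<lambda>z. (c * of_nat b) * of_real (fst z) ^ a * of_real (snd z) ^ (b - 1))"
  by (rule partial_unique; simp; rule has_vector_derivative_real_field;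
      auto intro!: derivative_eq_intros)+

lemma partial_add:
  assumes "p \<in> bipoly" "q \<in> bipoly"
  shows "partial_x (\<lambda>z. p z + q z) = (\<lambda>z. partial_x p z + partial_x q z)"
    and "partial_t (\<lambda>z. p z + q z) = (\<lambda>z. partial_t p z + partial_t q z)"
  by (rule partial_unique; rule has_vector_derivative_add;
      rule has_vector_derivative_bipoly; fact assms)+

lemma partial_mult:
  assumes "p \<in> bipoly" "q \<in> bipoly"
  shows "partial_x (\<lambda>z. p z * q z) = (\<lambda>z. p z * partial_x q z + partial_x p z * q z)"
    and "partial_t (\<lambda>z. p z * q z) = (\<lambda>z. p z * partial_t q z + partial_t p z * q z)"
  by (rule partial_unique; rule has_vector_derivative_mult;
      rule has_vector_derivative_bipoly; fact assms)+

lemma partial_cnj: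
  assumes "p \<in> bipoly"
  shows "partial_x (\<lambda>z. cnj (p z)) = (\<lambda>z. cnj (partial_x p z))"
    and "partial_t (\<lambda>z. cnj (p z)) = (\<lambda>z. cnj (partial_t p z))"
  by (rule partial_unique; rule has_vector_derivative_cnj;
      rule has_vector_derivative_bipoly; fact assms)+

lemma bipoly_partial:
  assumes "p \<in> bipoly"
  shows "partial_x p \<in> bipoly" "partial_t p \<in> bipoly"
proof -
  show "partial_x p \<in> bipoly"
    using assms by induction (simp_all only: partial_monom partial_add bipoly.intros)
  show "partial_t p \<in> bipoly"
    using assms by induction (simp_all only: partial_monom partial_add bipoly.intros)
qed

text \<open>The last property is the symmetry of the mixed second derivatives of A, which on
  monomials is an explicit computation. It makes \<open>transport p\<close> the x-derivative of
  \<open>partial_t A + p\<close>.\<close>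

lemma bipoly_antiderivative:
  assumes "p \<in> bipoly"
  obtains A where "A \<in> bipoly" "partial_x A = p" "partial_x (partial_t A) = partial_t p"
proof -
  have "\<exists>A\<in>bipoly. partial_x A = p \<and> partial_x (partial_t A) = partial_t p"
    using assms
  proof induction
    case (bipoly_monom c a b)
    let ?A = "\<lambda>z. c / of_nat (Suc a) * of_real (fst z) ^ Suc a * of_real (snd z) ^ b"
    have "(of_nat (Suc a) :: complex) \<noteq> 0" by (simp only: of_nat_eq_0_iff)
    then have 1: "c / of_nat (Suc a) * of_nat (Suc a) = c"
      by (simp del: of_nat_Suc)
    then have "c / of_nat (Suc a) * of_nat b * of_nat (Suc a) = c * of_nat b"
      by (metis mult.assoc mult.commute)
    with 1 show ?case
      by (intro bexI[of _ ?A] bipoly.bipoly_monom) (simp only: partial_monom diff_Suc_1 simp_thms)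
  next
    case (bipoly_add p q)
    then obtain A B where "A \<in> bipoly" "partial_x A = p" "partial_x (partial_t A) = partial_t p"
      "B \<in> bipoly" "partial_x B = q" "partial_x (partial_t B) = partial_t q" by blast
    with bipoly_add.hyps show ?case
      by (intro bexI[of _ "\<lambda>z. A z + B z"] bipoly.bipoly_add)
        (simp_all add: partial_add bipoly_partial)
  qed
  with that show ?thesis by blast
qed

text \<open>The chain rule along x = c + m t, checked on monomials so that no total derivative in
  the plane is needed.\<close>

lemma has_vector_derivative_bipoly_line:
  assumes "p \<in> bipoly"
  shows "((\<lambda>t. p (c + m * t, t)) has_vector_derivative
    of_real m * partial_x p (c + m * t, t) + partial_t p (c + m * t, t)) (at t within S)"
  using assms
proof induction
  case (bipoly_monom k a b)
  show ?case
    unfolding partial_monom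
    apply (simp only: fst_conv snd_conv of_real_add of_real_mult)
    apply (rule has_vector_derivative_real_field)
    apply (auto intro!: derivative_eq_intros simp: algebra_simps)
    done
next
  case (bipoly_add p q)
  then show ?case
    using has_vector_derivative_add[OF bipoly_add.IH]
    by (simp add: partial_add algebra_simps)
qed

section \<open>The divergence theorem on trapezoids\<close>

text \<open>The bounds on x are the linear interpolants between \<open>a0\<close>, \<open>a1\<close>
  and between \<open>b0\<close>, \<open>b1\<close>, multiplied by \<open>t1 - t0\<close> to avoid
  division.\<close>

definition trapezoid :: "real \<Rightarrow> real \<Rightarrow> real \<Rightarrow> real \<Rightarrow> real \<Rightarrow> real \<Rightarrow> (real \<times> real) set" where
  "trapezoid a0 a1 b0 b1 t0 t1 = {(x, t). t0 \<le> t \<and> t \<le> t1 \<and>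
     a0 * (t1 - t) + a1 * (t - t0) \<le> x * (t1 - t0) \<and> x * (t1 - t0) \<le> b0 * (t1 - t) + b1 * (t - t0)}"

text \<open>The spacetime divergence of the vector field (p, p).\<close>

definition transport :: "(real \<times> real \<Rightarrow> complex) \<Rightarrow> real \<times> real \<Rightarrow> complex" where
  "transport p z = partial_t p z + partial_x p z"

text \<open>\<open>seg_weight a b\<close> is the length of the segment times \<open>n\<^sub>x + n\<^sub>t\<close>, for the normal to the right of
  the direction from \<open>a\<close> to \<open>b\<close>.\<close>

definition seg_weight :: "real \<times> real \<Rightarrow> real \<times> real \<Rightarrow> real" where
  "seg_weight a b = (snd b - snd a) + (fst a - fst b)"

text \<open>The flux of (p, p) through the segment, to the right of the direction of travel: the
  length in the arc length element cancels the normalisation of the normal.\<close>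

definition seg_flux :: "(real \<times> real \<Rightarrow> complex) \<Rightarrow> real \<times> real \<Rightarrow> real \<times> real \<Rightarrow> complex" where
  "seg_flux p a b = of_real (seg_weight a b) * (LINT s:{0..1}|lborel. p (linepath a b s))"

section \<open>Reparametrisation of integrals along segments\<close>

lemma set_integral_Icc_reflect:
  fixes f :: "real \<Rightarrow> 'a::{banach, second_countable_topology}"
  shows "(LINT s:{0..1}|lborel. f (1 - s)) = (LINT s:{0..1}|lborel. f s)"
  unfolding set_lebesgue_integral_def
  by (subst (2) lborel_integral_real_affine[where c = "-1" and t = 1])
    (auto intro!: Bochner_Integration.integral_cong split: split_indicator)

lemma linepath_reflect: "linepath b a s = linepath a b (1 - s)"
  by (simp add: linepath_def algebra_simps)

lemma seg_flux_swap: "seg_flux p b a = - seg_flux p a b"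
  using set_integral_Icc_reflect[of "\<lambda>s. p (linepath a b s)"]
  by (simp add: seg_flux_def linepath_reflect[of b a] seg_weight_def algebra_simps)

lemma set_integral_Icc_affine:
  fixes f :: "real \<Rightarrow> complex"
  assumes "t0 < t1"
  shows "(LINT t:{t0..t1}|lborel. f t) =
    of_real (t1 - t0) * (LINT s:{0..1}|lborel. f (t0 + (t1 - t0) * s))"
proof -
  have "indicator {t0..t1} (t0 + (t1 - t0) * s) = (indicator {0..1} s :: real)" for s :: real
  proof -
    have "t0 + (t1 - t0) * s \<le> t1 \<longleftrightarrow> s \<le> 1"
      using assms mult_le_cancel_left_pos[of "t1 - t0" s 1] by (simp add: algebra_simps)
    then show ?thesis
      using assms by (auto simp: zero_le_mult_iff split: split_indicator)
  qed
  then show ?thesis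
    unfolding set_lebesgue_integral_def
    using assms by (subst lborel_integral_real_affine[where c = "t1 - t0" and t = t0]) (auto simp: scaleR_conv_of_real)
qed

text \<open>The weight of this segment is (t1 - t0) (1 - m); the factor t1 - t0 is the Jacobian that
  turns the unit parameter into time.\<close>

lemma seg_flux_graph:
  assumes "t0 < t1"
  shows "seg_flux p (c + m * t0, t0) (c + m * t1, t1) =
    of_real (1 - m) * (LINT t:{t0..t1}|lborel. p (c + m * t, t))"
proof -
  have "linepath (c + m * t0, t0) (c + m * t1, t1) s =
      (c + m * (t0 + (t1 - t0) * s), t0 + (t1 - t0) * s)" for s
    by (simp add: linepath_def algebra_simps)
  then show ?thesis
    by (simp add: set_integral_Icc_affine[OF assms] seg_flux_def seg_weight_def algebra_simps)
qed

lemma set_integrable_Icc_bipoly: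
  fixes a b :: real
  assumes "p \<in> bipoly" "continuous_on {a..b} f"
  shows "set_integrable lborel {a..b} (\<lambda>s. p (f s))"
  by (rule borel_integrable_atLeastAtMost'[OF continuous_on_bipoly[OF assms]])

text \<open>Compactness provides the integrability of polynomials that Fubini and the splitting of
  areas require.\<close>

lemma compact_trapezoid:
  assumes "t0 < t1"
  shows "compact (trapezoid a0 a1 b0 b1 t0 t1)"
proof -
  define R where "R = (\<bar>a0\<bar> + \<bar>a1\<bar>) + (\<bar>b0\<bar> + \<bar>b1\<bar>)"
  have bound: "\<bar>u * (t1 - t) + v * (t - t0)\<bar> \<le> (\<bar>u\<bar> + \<bar>v\<bar>) * (t1 - t0)"
    if "t0 \<le> t" "t \<le> t1" for u v t
  proof -
    have "\<bar>u * (t1 - t)\<bar> \<le> \<bar>u\<bar> * (t1 - t0)" "\<bar>v * (t - t0)\<bar> \<le> \<bar>v\<bar> * (t1 - t0)"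
      using that by (auto simp: abs_mult intro!: mult_left_mono)
    then show ?thesis by (auto simp: distrib_right intro: order_trans[OF abs_triangle_ineq])
  qed
  have "-R \<le> x \<and> x \<le> R" if "(x, t) \<in> trapezoid a0 a1 b0 b1 t0 t1" for x t
  proof -
    have "\<bar>a0 * (t1 - t) + a1 * (t - t0)\<bar> \<le> (\<bar>a0\<bar> + \<bar>a1\<bar>) * (t1 - t0)"
      "\<bar>b0 * (t1 - t) + b1 * (t - t0)\<bar> \<le> (\<bar>b0\<bar> + \<bar>b1\<bar>) * (t1 - t0)"
      using that by (auto simp: trapezoid_def intro!: bound)
    moreover have "0 \<le> (\<bar>a0\<bar> + \<bar>a1\<bar>) * (t1 - t0)" "0 \<le> (\<bar>b0\<bar> + \<bar>b1\<bar>) * (t1 - t0)"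
      using assms by auto
    moreover have "a0 * (t1 - t) + a1 * (t - t0) \<le> x * (t1 - t0)"
      "x * (t1 - t0) \<le> b0 * (t1 - t) + b1 * (t - t0)"
      using that by (auto simp: trapezoid_def)
    moreover have "R * (t1 - t0) = (\<bar>a0\<bar> + \<bar>a1\<bar>) * (t1 - t0) + (\<bar>b0\<bar> + \<bar>b1\<bar>) * (t1 - t0)"
      by (simp only: R_def distrib_right)
    ultimately have "-R * (t1 - t0) \<le> x * (t1 - t0)" "x * (t1 - t0) \<le> R * (t1 - t0)"
      unfolding mult_minus_left by linarith+
    then show ?thesis
      using assms mult_le_cancel_right_pos[of "t1 - t0" "-R" x] mult_le_cancel_right_pos[of "t1 - t0" x R]
      by simp
  qed
  then have "trapezoid a0 a1 b0 b1 t0 t1 \<subseteq> cbox (-R, t0) (R, t1)"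
    by (auto simp: trapezoid_def)
  then have "bounded (trapezoid a0 a1 b0 b1 t0 t1)"
    by (rule bounded_subset[OF bounded_cbox])
  moreover have "trapezoid a0 a1 b0 b1 t0 t1 =
      {z. t0 \<le> snd z} \<inter> {z. snd z \<le> t1} \<inter>
      {z. a0 * (t1 - snd z) + a1 * (snd z - t0) \<le> fst z * (t1 - t0)} \<inter>
      {z. fst z * (t1 - t0) \<le> b0 * (t1 - snd z) + b1 * (snd z - t0)}"
    by (auto simp: trapezoid_def)
  moreover have "closed \<dots>"
    by (intro closed_Int closed_Collect_le continuous_intros)
  ultimately show ?thesis by (simp add: compact_eq_bounded_closed)
qed

lemma set_integrable_compact_bipoly:
  assumes "p \<in> bipoly" "compact S"
  shows "set_integrable lborel S p"
  unfolding set_integrable_def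
  using continuous_on_bipoly[OF assms(1) continuous_on_id] by (intro borel_integrable_compact assms) auto

lemma bipoly_transport: "p \<in> bipoly \<Longrightarrow> transport p \<in> bipoly"
  using bipoly_add[OF bipoly_partial(2) bipoly_partial(1)] by (simp add: transport_def[abs_def])

lemma Icc_integral_FTC:
  fixes F :: "real \<Rightarrow> complex"
  assumes "a \<le> b" "\<And>x. (F has_vector_derivative f x) (at x within {a..b})" "continuous_on {a..b} f"
  shows "(LINT x:{a..b}|lborel. f x) = F b - F a"
  unfolding set_lebesgue_integral_def using assms by (intro integral_FTC_atLeastAtMost) auto

text \<open>If \<open>A\<close> is an antiderivative of \<open>p\<close> in \<open>x\<close>, the horizontal slice of the area integral is
  the increment of \<open>p + \<partial>\<^sub>t A\<close> between the two slanted sides, and along such a side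
  \<open>\<partial>\<^sub>t A\<close> is a total derivative minus \<open>p\<close> times the slope.\<close>

lemma transport_integral_between_lines:
  assumes p: "p \<in> bipoly" and "t0 < t1"
    and le: "\<And>t. t0 \<le> t \<Longrightarrow> t \<le> t1 \<Longrightarrow> c + m * t \<le> d + k * t"
    and T: "T = {(x, t). t0 \<le> t \<and> t \<le> t1 \<and> c + m * t \<le> x \<and> x \<le> d + k * t}" "compact T"
  shows "(LINT z:T|lborel. transport p z) =
    (LINT x:{c + m * t1..d + k * t1}|lborel. p (x, t1)) - (LINT x:{c + m * t0..d + k * t0}|lborel. p (x, t0))
    + of_real (1 - k) * (LINT t:{t0..t1}|lborel. p (d + k * t, t))
    - of_real (1 - m) * (LINT t:{t0..t1}|lborel. p (c + m * t, t))"
proof -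
  obtain A where A: "A \<in> bipoly" "partial_x A = p" "partial_x (partial_t A) = partial_t p"
    using bipoly_antiderivative[OF p] .
  note mem = p A(1) bipoly_partial[OF A(1)] bipoly_partial[OF p]
  have slice: "(LINT x:{a..b}|lborel. transport p (x, t)) =
      (partial_t A (b, t) + p (b, t)) - (partial_t A (a, t) + p (a, t))" if "a \<le> b" for a b t
  proof (rule Icc_integral_FTC[OF that])
    show "((\<lambda>x. partial_t A (x, t) + p (x, t)) has_vector_derivative transport p (x, t)) (at x within {a..b})" for x
      using has_vector_derivative_add[OF has_vector_derivative_bipoly(1)[OF mem(4)] has_vector_derivative_bipoly(1)[OF p]]
      by (auto simp: A(3) transport_def intro: has_vector_derivative_at_within)
  qed (intro continuous_intros continuous_on_bipoly bipoly_transport p)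
  have slice': "(LINT x:{a..b}|lborel. p (x, t)) = A (b, t) - A (a, t)" if "a \<le> b" for a b t
    using has_vector_derivative_bipoly(1)[OF A(1)]
    by (intro Icc_integral_FTC that)
      (auto simp: A(2) intro: has_vector_derivative_at_within intro!: continuous_intros continuous_on_bipoly mem)
  have side: "(LINT t:{t0..t1}|lborel. partial_t A (e + l * t, t) + p (e + l * t, t)) =
      A (e + l * t1, t1) - A (e + l * t0, t0) + of_real (1 - l) * (LINT t:{t0..t1}|lborel. p (e + l * t, t))"
    for e l
  proof -
    have int: "set_integrable lborel {t0..t1} (\<lambda>t. p (e + l * t, t))"
      "set_integrable lborel {t0..t1} (\<lambda>t. partial_t A (e + l * t, t))"
      by (intro set_integrable_Icc_bipoly mem continuous_intros)+
    have "(LINT t:{t0..t1}|lborel. of_real l * p (e + l * t, t) + partial_t A (e + l * t, t)) =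
        A (e + l * t1, t1) - A (e + l * t0, t0)"
    proof (rule Icc_integral_FTC)
      have "continuous_on {t0..t1} (\<lambda>t. f (e + l * t, t))" if "f \<in> bipoly" for f
        by (intro continuous_on_bipoly[OF that] continuous_intros)
      then show "continuous_on {t0..t1} (\<lambda>t. of_real l * p (e + l * t, t) + partial_t A (e + l * t, t))"
        by (intro continuous_intros) (use mem in blast)+
    qed (use has_vector_derivative_bipoly_line[OF A(1)] \<open>t0 < t1\<close> in \<open>simp_all add: A(2)\<close>)
    then show ?thesis
      using int by (simp add: set_integral_add algebra_simps)
  qed
  have int: "integrable (lborel \<Otimes>\<^sub>M lborel) (\<lambda>(x, t). indicator T (x, t) *\<^sub>R transport p (x, t))"
    using set_integrable_compact_bipoly[OF bipoly_transport[OF p] T(2)]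
    by (simp add: lborel_prod set_integrable_def split_def)
  have "(LINT z:T|lborel. transport p z) =
      (LINT t|lborel. LINT x|lborel. indicator T (x, t) *\<^sub>R transport p (x, t))"
    using lborel_pair.integral_snd[OF int] by (simp add: lborel_prod set_lebesgue_integral_def split_def)
  also have "\<dots> = (LINT t:{t0..t1}|lborel. LINT x:{c + m * t..d + k * t}|lborel. transport p (x, t))"
    unfolding set_lebesgue_integral_def
  proof (rule Bochner_Integration.integral_cong[OF refl])
    fix t
    have "indicator T (x, t) = (indicator {t0..t1} t * indicator {c + m * t..d + k * t} x :: real)" for x
      by (auto simp: T(1) split: split_indicator)
    then show "(LINT x|lborel. indicator T (x, t) *\<^sub>R transport p (x, t)) =
        indicator {t0..t1} t *\<^sub>R (LINT x|lborel. indicator {c + m * t..d + k * t} x *\<^sub>R transport p (x, t))"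
      by (simp flip: scaleR_scaleR)
  qed
  also have "\<dots> = (LINT t:{t0..t1}|lborel.
      (partial_t A (d + k * t, t) + p (d + k * t, t)) - (partial_t A (c + m * t, t) + p (c + m * t, t)))"
    by (rule set_lebesgue_integral_cong) (auto intro!: slice le)
  also have "\<dots> = (LINT t:{t0..t1}|lborel. partial_t A (d + k * t, t) + p (d + k * t, t))
      - (LINT t:{t0..t1}|lborel. partial_t A (c + m * t, t) + p (c + m * t, t))"
    by (intro set_integral_diff set_integral_add set_integrable_Icc_bipoly mem continuous_intros)
  \<comment> \<open>The values of A left over by \<open>side\<close> sit at the four corners; by
    \<open>slice'\<close> they pair up into the integrals over the two horizontal sides.\<close>
  finally show ?thesis
    using le[of t0] le[of t1] \<open>t0 < t1\<close> by (simp add: side slice' del: of_real_diff)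
qed

text \<open>The slanted sides are rewritten as graphs over t. Traversing the left side downwards
  absorbs the minus sign in front of its integral.\<close>

lemma transport_integral_trapezoid:
  assumes p: "p \<in> bipoly" and t: "t0 < t1" and le: "a0 \<le> b0" "a1 \<le> b1"
  shows "(LINT z:trapezoid a0 a1 b0 b1 t0 t1|lborel. transport p z) =
    (LINT x:{a1..b1}|lborel. p (x, t1)) - (LINT x:{a0..b0}|lborel. p (x, t0))
    + seg_flux p (b0, t0) (b1, t1) + seg_flux p (a1, t1) (a0, t0)"
proof -
  define m where "m = (a1 - a0) / (t1 - t0)"
  define k where "k = (b1 - b0) / (t1 - t0)"
  define c where "c = a0 - m * t0"
  define d where "d = b0 - k * t0"
  have ends: "c + m * t0 = a0" "d + k * t0 = b0" "c + m * t1 = a1" "d + k * t1 = b1"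
  proof -
    have "m * (t1 - t0) = a1 - a0" "k * (t1 - t0) = b1 - b0"
      using t by (simp_all add: m_def k_def)
    then show "c + m * t0 = a0" "d + k * t0 = b0" "c + m * t1 = a1" "d + k * t1 = b1"
      by (simp_all add: c_def d_def algebra_simps)
  qed
  have interp: "(e + l * t) * (t1 - t0) = (e + l * t0) * (t1 - t) + (e + l * t1) * (t - t0)" for e l t
    by (simp add: algebra_simps)
  have line: "c + m * t \<le> x \<longleftrightarrow> a0 * (t1 - t) + a1 * (t - t0) \<le> x * (t1 - t0)"
    "x \<le> d + k * t \<longleftrightarrow> x * (t1 - t0) \<le> b0 * (t1 - t) + b1 * (t - t0)" for x t
    using interp[of c m t] interp[of d k t] t mult_le_cancel_right_pos[of "t1 - t0" "c + m * t" x]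
      mult_le_cancel_right_pos[of "t1 - t0" x "d + k * t"]
    by (simp_all add: ends)
  have T: "trapezoid a0 a1 b0 b1 t0 t1 = {(x, t). t0 \<le> t \<and> t \<le> t1 \<and> c + m * t \<le> x \<and> x \<le> d + k * t}"
    by (simp add: trapezoid_def line)
  have ord: "c + m * t \<le> d + k * t" if "t0 \<le> t" "t \<le> t1" for t
  proof -
    have "a0 * (t1 - t) + a1 * (t - t0) \<le> b0 * (t1 - t) + b1 * (t - t0)"
      using that le by (intro add_mono mult_right_mono) auto
    then show ?thesis
      using interp[of d k t] by (simp add: line(1) ends)
  qed
  have flux: "seg_flux p (b0, t0) (b1, t1) = of_real (1 - k) * (LINT t:{t0..t1}|lborel. p (d + k * t, t))"
    "seg_flux p (a0, t0) (a1, t1) = of_real (1 - m) * (LINT t:{t0..t1}|lborel. p (c + m * t, t))"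
    using seg_flux_graph[OF t, of p d k] seg_flux_graph[OF t, of p c m] by (simp_all add: ends)
  show ?thesis
    using transport_integral_between_lines[OF p t ord T compact_trapezoid[OF t]]
    by (simp add: ends flux seg_flux_swap[of p "(a1, t1)"] del: of_real_diff)
qed

text \<open>The left sides run through the abscissae \<open>a0, a1, a2\<close> and the right sides through \<open>b0, b1, b2\<close>, at
  the times \<open>t0\<close>, \<open>t0 + h\<close> and \<open>t0 + 2 h\<close>.  A sliver and the two kinds of control volumes are
  degenerate cases.\<close>

definition hexagon :: "real \<Rightarrow> real \<Rightarrow> real \<Rightarrow> real \<Rightarrow> real \<Rightarrow> real \<Rightarrow> real \<Rightarrow> real \<Rightarrow> (real \<times> real) set" where
  "hexagon a0 a1 a2 b0 b1 b2 t0 h =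
     trapezoid a0 a1 b0 b1 t0 (t0 + h) \<union> trapezoid a1 a2 b1 b2 (t0 + h) (t0 + 2 * h)"

text \<open>Used to disregard the edges that two closed regions share.\<close>

lemma AE_not_on_line:
  fixes a c :: real
  assumes "a \<noteq> 0 \<or> c \<noteq> 0"
  shows "AE z in lborel. a * fst z + c * snd z \<noteq> d"
proof -
  have "negligible {z. (a, c) \<bullet> z = d}"
    using assms by (intro negligible_hyperplane) (auto simp: zero_prod_def)
  then have "AE z in lebesgue. z \<notin> {z. (a, c) \<bullet> z = d}"
    by (intro AE_not_in) (simp add: negligible_iff_null_sets)
  then show ?thesis
    by (simp add: AE_completion_iff inner_prod_def)
qed

text \<open>The trapezoids overlap only at height t + h, and the integrals over their common
  horizontal side occur with opposite signs.\<close>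

lemma transport_integral_hexagon:
  assumes p: "p \<in> bipoly" and h: "h > 0" and le: "a0 \<le> b0" "a1 \<le> b1" "a2 \<le> b2"
  shows "(LINT z:hexagon a0 a1 a2 b0 b1 b2 t h|lborel. transport p z) =
    (LINT x:{a2..b2}|lborel. p (x, t + 2 * h)) - (LINT x:{a0..b0}|lborel. p (x, t))
    + (seg_flux p (b0, t) (b1, t + h) + seg_flux p (b1, t + h) (b2, t + 2 * h))
    + (seg_flux p (a2, t + 2 * h) (a1, t + h) + seg_flux p (a1, t + h) (a0, t))"
proof -
  let ?L = "trapezoid a0 a1 b0 b1 t (t + h)" and ?U = "trapezoid a1 a2 b1 b2 (t + h) (t + 2 * h)"
  have cpt: "compact ?L" "compact ?U"
    using h by (auto intro: compact_trapezoid)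
  have "AE z in lborel. \<not> (z \<in> ?L \<and> z \<in> ?U)"
    using AE_not_on_line[of 0 1 "t + h"] by (auto simp: trapezoid_def elim!: eventually_mono)
  then have "(LINT z:?L \<union> ?U|lborel. transport p z) =
      (LINT z:?L|lborel. transport p z) + (LINT z:?U|lborel. transport p z)"
    using cpt by (intro set_integral_Un_AE set_integrable_compact_bipoly bipoly_transport p)
      (auto intro: borel_compact)
  then show ?thesis
    using h le by (simp add: hexagon_def transport_integral_trapezoid[OF p])
qed

lemma compact_hexagon: "h > 0 \<Longrightarrow> compact (hexagon a0 a1 a2 b0 b1 b2 t h)"
  by (auto simp: hexagon_def intro!: compact_Un compact_trapezoid)

section \<open>Slivers and control volumes\<close>

lemma convex_comb4:
  assumes "convex C" "p1 \<in> C" "p2 \<in> C" "p3 \<in> C" "p4 \<in> C"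
    and "w1 \<ge> 0" "w2 \<ge> 0" "w3 \<ge> 0" "w4 \<ge> 0" "w1 + w2 + w3 + w4 = 1"
  shows "w1 *\<^sub>R p1 + w2 *\<^sub>R p2 + w3 *\<^sub>R p3 + w4 *\<^sub>R p4 \<in> C"
proof -
  have "(\<Sum>i<4. (([w1, w2, w3, w4] ! i) *\<^sub>R ([p1, p2, p3, p4] ! i))) \<in> C"
    by (rule convex_sum) (use assms in \<open>auto simp: numeral_eq_Suc less_Suc_eq\<close>)
  then show ?thesis by (simp add: numeral_eq_Suc add.assoc)
qed

text \<open>A ball of a weighted l1 norm: |X| / d + |s| / h \<le> 1 around the centre (x, t + h),
  with denominators cleared.\<close>

definition diamond :: "real \<Rightarrow> real \<Rightarrow> real \<Rightarrow> real \<Rightarrow> (real \<times> real) set" where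
  "diamond x t d h = {z. \<bar>fst z - x\<bar> * h + d * \<bar>snd z - t - h\<bar> \<le> d * h}"

lemma abs_mult_le_iff:
  fixes X s d h k :: real
  assumes "h > 0" "d > 0"
  shows "\<bar>X\<bar> * h + d * \<bar>s\<bar> \<le> k \<longleftrightarrow>
    X * h + d * s \<le> k \<and> X * h - d * s \<le> k \<and> - (X * h) + d * s \<le> k \<and> - (X * h) - d * s \<le> k"
proof -
  have "\<bar>X\<bar> * h = \<bar>X * h\<bar>" "d * \<bar>s\<bar> = \<bar>d * s\<bar>"
    using assms by (simp_all add: abs_mult)
  then show ?thesis by linarith
qed

lemma diamond_halfspaces:
  assumes "h > 0" "d > 0"
  shows "diamond x t d h = {z. (h, d) \<bullet> z \<le> x * h + d * (t + h) + d * h} \<inter>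
    {z. (h, - d) \<bullet> z \<le> x * h - d * (t + h) + d * h} \<inter>
    {z. (- h, d) \<bullet> z \<le> - x * h + d * (t + h) + d * h} \<inter>
    {z. (- h, - d) \<bullet> z \<le> - x * h - d * (t + h) + d * h}"
  unfolding diamond_def abs_mult_le_iff[OF assms]
  by (auto simp: inner_prod_def algebra_simps)

lemma convex_hull_diamond:
  assumes "h > 0" "d > 0"
  shows "convex hull {(x, t), (x + d, t + h), (x, t + 2 * h), (x - d, t + h)} = diamond x t d h"
proof (rule subset_antisym)
  have "convex (diamond x t d h)"
    unfolding diamond_halfspaces[OF assms] by (intro convex_Int convex_halfspace_le)
  then show "convex hull {(x, t), (x + d, t + h), (x, t + 2 * h), (x - d, t + h)} \<subseteq> diamond x t d h"
    using assms by (intro hull_minimal) (auto simp: diamond_def)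
  show "diamond x t d h \<subseteq> convex hull {(x, t), (x + d, t + h), (x, t + 2 * h), (x - d, t + h)}"
    (is "_ \<subseteq> ?C")
  proof
    fix z assume z: "z \<in> diamond x t d h"
    define u where "u = (fst z - x) / d"
    define v where "v = (snd z - t - h) / h"
    \<comment> \<open>The positive and negative parts of u and v, used as weights of the vertices,
      reproduce the offset of z from the centre. The missing mass 1 - |u| - |v| is spread equally
      over the four vertices, whose mean is the centre, so it does not move the point.\<close>
    define r where "r = (1 - \<bar>u\<bar> - \<bar>v\<bar>) / 4"
    have uv: "fst z = x + d * u" "snd z = t + h + h * v"
      using assms by (simp_all add: u_def v_def)
    have "(\<bar>u\<bar> + \<bar>v\<bar>) * (d * h) \<le> 1 * (d * h)"
      using z assms by (simp add: diamond_def uv abs_mult algebra_simps)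
    then have r: "r \<ge> 0"
      using assms mult_le_cancel_right_pos[of "d * h" "\<bar>u\<bar> + \<bar>v\<bar>" 1] by (simp add: r_def)
    have s: "max (- v) 0 + max u 0 + max v 0 + max (- u) 0 + 4 * r = 1"
    proof -
      have "max u 0 + max (- u) 0 = \<bar>u\<bar>" "max v 0 + max (- v) 0 = \<bar>v\<bar>" by auto
      moreover have "4 * r = 1 - \<bar>u\<bar> - \<bar>v\<bar>" by (simp add: r_def)
      ultimately show ?thesis by linarith
    qed
    have "(max (- v) 0 + r) *\<^sub>R (x, t) + (max u 0 + r) *\<^sub>R (x + d, t + h)
        + (max v 0 + r) *\<^sub>R (x, t + 2 * h) + (max (- u) 0 + r) *\<^sub>R (x - d, t + h) \<in> ?C"
      using r s by (intro convex_comb4 convex_convex_hull hull_inc) auto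
    moreover have "(max (- v) 0 + r) *\<^sub>R (x, t) + (max u 0 + r) *\<^sub>R (x + d, t + h)
        + (max v 0 + r) *\<^sub>R (x, t + 2 * h) + (max (- u) 0 + r) *\<^sub>R (x - d, t + h) = z"
    proof -
      have "(max (- v) 0 + r) * x + (max u 0 + r) * (x + d) + (max v 0 + r) * x + (max (- u) 0 + r) * (x - d)
          = (max (- v) 0 + max u 0 + max v 0 + max (- u) 0 + 4 * r) * x + d * (max u 0 - max (- u) 0)"
        by (simp add: algebra_simps)
      moreover have "(max (- v) 0 + r) * t + (max u 0 + r) * (t + h) + (max v 0 + r) * (t + 2 * h)
            + (max (- u) 0 + r) * (t + h)
          = (max (- v) 0 + max u 0 + max v 0 + max (- u) 0 + 4 * r) * (t + h) + h * (max v 0 - max (- v) 0)"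
        by (simp add: algebra_simps)
      moreover have "max u 0 - max (- u) 0 = u" "max v 0 - max (- v) 0 = v"
        by auto
      ultimately show ?thesis
        unfolding s by (simp add: prod_eq_iff uv)
    qed
    ultimately show "z \<in> ?C" by simp
  qed
qed

text \<open>Time is counted from the middle level, where both halves have the abscissae
  \<open>a1\<close> and \<open>b1\<close>; the two disjuncts then differ only in the slopes.\<close>

lemma mem_hexagon:
  assumes "h > 0"
  shows "(x, t + h + s) \<in> hexagon a0 a1 a2 b0 b1 b2 t h \<longleftrightarrow>
    - h \<le> s \<and> s \<le> 0 \<and> a1 * h + (a1 - a0) * s \<le> x * h \<and> x * h \<le> b1 * h + (b1 - b0) * s \<or>
    0 \<le> s \<and> s \<le> h \<and> a1 * h + (a2 - a1) * s \<le> x * h \<and> x * h \<le> b1 * h + (b2 - b1) * s"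
  by (simp add: hexagon_def trapezoid_def algebra_simps) (auto simp: algebra_simps)

lemma diamond_eq_hexagon:
  assumes "h > 0" "d > 0"
  shows "diamond x t d h = hexagon x (x - d) x x (x + d) x t h"
proof (intro set_eqI)
  fix z :: "real \<times> real"
  define X s where "X = fst z - x" and "s = snd z - t - h"
  have z: "z = (x + X, t + h + s)" by (simp add: X_def s_def)
  \<comment> \<open>The hexagon bounds time explicitly, whereas in the diamond this bound is
    implicit.\<close>
  have "\<bar>s\<bar> \<le> h" if "\<bar>X\<bar> * h + d * \<bar>s\<bar> \<le> d * h"
  proof -
    have "d * \<bar>s\<bar> \<le> d * h" using that assms by (smt (verit) mult_nonneg_nonneg abs_ge_zero)
    then show ?thesis using assms by simp
  qed
  moreover have "\<bar>X\<bar> * h = \<bar>X * h\<bar>" using assms by (simp add: abs_mult)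
  ultimately show "z \<in> diamond x t d h \<longleftrightarrow> z \<in> hexagon x (x - d) x x (x + d) x t h"
    unfolding z mem_hexagon[OF assms(1)] using assms
    by (cases "s \<ge> 0") (auto simp: diamond_def algebra_simps abs_le_iff)
qed

section \<open>Control volumes as hexagons up to null sets\<close>

context
  fixes x t d h :: real
  assumes h: "h > 0" and d: "d > 0"
begin

text \<open>The diamond removed is closed, so its two right edges are in the hexagon but not in the
  difference. They lie on two lines, hence form a null set.\<close>

lemma AE_rect_diff_diamond_right:
  assumes "x + d \<le> y"
  shows "{x..y} \<times> {t..t + 2 * h} - diamond x t d h \<subseteq> hexagon x (x + d) x y y y t h"
    and "AE z in lborel. z \<in> hexagon x (x + d) x y y y t h \<longrightarrow>
      z \<in> {x..y} \<times> {t..t + 2 * h} - diamond x t d h"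
proof -
  have iff: "(x + X, t + h + s) \<in> hexagon x (x + d) x y y y t h \<longleftrightarrow>
      \<bar>s\<bar> \<le> h \<and> d * h \<le> X * h + d * \<bar>s\<bar> \<and> x + X \<le> y" for X s
  proof -
    have "x + X \<le> y \<longleftrightarrow> x * h + X * h \<le> y * h"
      using mult_le_cancel_right_pos[OF h, of "x + X" y] by (simp add: distrib_right)
    then show ?thesis
      unfolding mem_hexagon[OF h] by (cases "s \<ge> 0") (auto simp: algebra_simps)
  qed
  have dia: "(x + X, t + h + s) \<in> diamond x t d h \<longleftrightarrow> X * h + d * \<bar>s\<bar> \<le> d * h" if "X \<ge> 0" for X s
    using that by (simp add: diamond_def)
  show "{x..y} \<times> {t..t + 2 * h} - diamond x t d h \<subseteq> hexagon x (x + d) x y y y t h"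
  proof
    fix z assume z: "z \<in> {x..y} \<times> {t..t + 2 * h} - diamond x t d h"
    then show "z \<in> hexagon x (x + d) x y y y t h"
      using iff[of "fst z - x" "snd z - t - h"] dia[of "fst z - x" "snd z - t - h"]
      by (cases z) auto
  qed
  have h0: "h \<noteq> 0" using h by simp
  show "AE z in lborel. z \<in> hexagon x (x + d) x y y y t h \<longrightarrow>
      z \<in> {x..y} \<times> {t..t + 2 * h} - diamond x t d h"
    \<comment> \<open>In coordinates relative to the centre, these are the lines X h + d s = d h and
      X h - d s = d h carrying the right edges.\<close>
    using AE_not_on_line[OF disjI1[OF h0], of d "x * h + d * (t + h) + d * h"]
      AE_not_on_line[OF disjI1[OF h0], of "- d" "x * h - d * (t + h) + d * h"]
  proof eventually_elim
    case (elim z)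
    define X s where "X = fst z - x" and "s = snd z - t - h"
    have z: "z = (x + X, t + h + s)" by (simp add: X_def s_def)
    have ne: "X * h + d * \<bar>s\<bar> \<noteq> d * h"
      using elim by (auto simp: z algebra_simps abs_if)
    show ?case
    proof
      assume "z \<in> hexagon x (x + d) x y y y t h"
      then have *: "\<bar>s\<bar> \<le> h" "d * h \<le> X * h + d * \<bar>s\<bar>" "x + X \<le> y" by (auto simp: z iff)
      moreover have "d * \<bar>s\<bar> \<le> d * h" using * d by simp
      ultimately have "X \<ge> 0" using h by (smt (verit) mult_neg_pos)
      with * ne dia show "z \<in> {x..y} \<times> {t..t + 2 * h} - diamond x t d h"
        by (auto simp: z)
    qed
  qed
qed

text \<open>The mirror image of \<open>AE_rect_diff_diamond_right\<close>, with X now measured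
  leftwards from x.\<close>

lemma AE_rect_diff_diamond_left:
  assumes "y \<le> x - d"
  shows "{y..x} \<times> {t..t + 2 * h} - diamond x t d h \<subseteq> hexagon y y y x (x - d) x t h"
    and "AE z in lborel. z \<in> hexagon y y y x (x - d) x t h \<longrightarrow>
      z \<in> {y..x} \<times> {t..t + 2 * h} - diamond x t d h"
proof -
  have iff: "(x - X, t + h + s) \<in> hexagon y y y x (x - d) x t h \<longleftrightarrow>
      \<bar>s\<bar> \<le> h \<and> d * h \<le> X * h + d * \<bar>s\<bar> \<and> y \<le> x - X" for X s
  proof -
    have "y \<le> x - X \<longleftrightarrow> y * h \<le> x * h - X * h"
      using mult_le_cancel_right_pos[OF h, of y "x - X"] by (simp add: left_diff_distrib)
    then show ?thesis
      unfolding mem_hexagon[OF h] by (cases "s \<ge> 0") (auto simp: algebra_simps)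
  qed
  have dia: "(x - X, t + h + s) \<in> diamond x t d h \<longleftrightarrow> X * h + d * \<bar>s\<bar> \<le> d * h" if "X \<ge> 0" for X s
    using that by (simp add: diamond_def)
  show "{y..x} \<times> {t..t + 2 * h} - diamond x t d h \<subseteq> hexagon y y y x (x - d) x t h"
  proof
    fix z assume z: "z \<in> {y..x} \<times> {t..t + 2 * h} - diamond x t d h"
    then show "z \<in> hexagon y y y x (x - d) x t h"
      using iff[of "x - fst z" "snd z - t - h"] dia[of "x - fst z" "snd z - t - h"]
      by (cases z) auto
  qed
  have h0: "h \<noteq> 0" using h by simp
  show "AE z in lborel. z \<in> hexagon y y y x (x - d) x t h \<longrightarrow>
      z \<in> {y..x} \<times> {t..t + 2 * h} - diamond x t d h"
    using AE_not_on_line[OF disjI1[OF h0], of d "x * h + d * (t + h) - d * h"]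
      AE_not_on_line[OF disjI1[OF h0], of "- d" "x * h - d * (t + h) - d * h"]
  proof eventually_elim
    case (elim z)
    define X s where "X = x - fst z" and "s = snd z - t - h"
    have z: "z = (x - X, t + h + s)" by (simp add: X_def s_def)
    have ne: "X * h + d * \<bar>s\<bar> \<noteq> d * h"
      using elim by (auto simp: z algebra_simps abs_if)
    show ?case
    proof
      assume "z \<in> hexagon y y y x (x - d) x t h"
      then have *: "\<bar>s\<bar> \<le> h" "d * h \<le> X * h + d * \<bar>s\<bar>" "y \<le> x - X" by (auto simp: z iff)
      moreover have "d * \<bar>s\<bar> \<le> d * h" using * d by simp
      ultimately have "X \<ge> 0" using h by (smt (verit) mult_neg_pos)
      with * ne dia show "z \<in> {y..x} \<times> {t..t + 2 * h} - diamond x t d h"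
        by (auto simp: z)
    qed
  qed
qed

end

text \<open>Deals with the closure in \<open>control_volume\<close>: H is closed, so the closure of
  R lies between R and H, which agree almost everywhere.\<close>

lemma set_integral_closure_cong:
  fixes f :: "'a::euclidean_space \<Rightarrow> complex"
  assumes "R \<subseteq> H" "compact H" "AE z in lborel. z \<in> H \<longrightarrow> z \<in> R" "f \<in> borel_measurable borel"
  shows "(LINT z:closure R|lborel. f z) = (LINT z:H|lborel. f z)"
proof (rule set_integral_cong_set)
  have "closure R \<subseteq> H"
    using assms by (simp add: closure_minimal compact_imp_closed)
  then show "AE z in lborel. z \<in> H \<longleftrightarrow> z \<in> closure R"
    using assms(3) closure_subset[of R] by (auto elim!: eventually_mono)
  show "set_borel_measurable lborel H f" "set_borel_measurable lborel (closure R) f"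
    using assms unfolding set_borel_measurable_def
    by (auto intro!: borel_measurable_scaleR borel_measurable_indicator borel_closed compact_imp_closed)
qed

lemma borel_measurable_bipoly: "p \<in> bipoly \<Longrightarrow> p \<in> borel_measurable borel"
  using continuous_on_bipoly[of p UNIV "\<lambda>x. x"] by (auto intro: borel_measurable_continuous_onI)

lemma set_integral_singleton_lborel:
  fixes f :: "real \<Rightarrow> complex"
  shows "(LINT x:{a}|lborel. f x) = 0"
  unfolding set_lebesgue_integral_def
  by (rule integral_eq_zero_AE) (use AE_lborel_singleton[of a] in \<open>auto elim!: eventually_mono\<close>)

lemma tlev_Suc: "tlev \<Delta>t (Suc n) = tlev \<Delta>t n + 2 * (\<Delta>t / 2)"
  by (simp add: tlev_def algebra_simps)

lemma sliver_eq_diamond: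
  assumes "\<Delta>x > 0" "\<Delta>t > 0" "\<delta> > 0"
  shows "sliver \<Delta>x \<Delta>t \<delta> n i = diamond (xleft \<Delta>x i) (tlev \<Delta>t n) (\<delta> * \<Delta>x) (\<Delta>t / 2)"
  using convex_hull_diamond[of "\<Delta>t / 2" "\<delta> * \<Delta>x" "xleft \<Delta>x i" "tlev \<Delta>t n"] assms
  by (simp add: sliver_def sliver_bot_def sliver_right_def sliver_top_def sliver_left_def tlev_Suc)

section \<open>The divergence theorem on the cells of the scheme\<close>

definition face_flux :: "(real \<times> real \<Rightarrow> complex) \<Rightarrow> face \<Rightarrow> complex" where
  "face_flux p F = (\<Sum>(a, b)\<leftarrow>F. seg_flux p a b)"

lemma transport_integral_sliver:
  assumes p: "p \<in> bipoly" and pos: "\<Delta>x > 0" "\<Delta>t > 0" "\<delta> > 0"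
  shows "(LINT z:sliver \<Delta>x \<Delta>t \<delta> n i|lborel. transport p z) =
    face_flux p (sliver_face_left \<Delta>x \<Delta>t \<delta> n i) + face_flux p (sliver_face_right \<Delta>x \<Delta>t \<delta> n i)"
proof -
  define h where "h = \<Delta>t / 2"
  have h: "h > 0" and d: "\<delta> * \<Delta>x > 0" using pos by (auto simp: h_def)
  have le: "xleft \<Delta>x i - \<delta> * \<Delta>x \<le> xleft \<Delta>x i + \<delta> * \<Delta>x" using d by linarith
  show ?thesis
    using d by (simp add: sliver_eq_diamond pos diamond_eq_hexagon transport_integral_hexagon[OF p h order_refl le order_refl]
        face_flux_def sliver_face_left_def sliver_face_right_def
        sliver_bot_def sliver_right_def sliver_top_def sliver_left_def tlev_Suc
        set_integral_singleton_lborel h flip: h_def)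
qed

text \<open>A hexagon breaks its vertical side at the half time level, while the scheme treats a
  vertical interface as a single segment.\<close>

lemma seg_flux_vertical_split:
  assumes "p \<in> bipoly" "h > 0"
  shows "seg_flux p (x, t) (x, t + 2 * h) = seg_flux p (x, t) (x, t + h) + seg_flux p (x, t + h) (x, t + 2 * h)"
proof -
  have flux: "seg_flux p (x, t0) (x, t1) = (LINT t:{t0..t1}|lborel. p (x, t))" if "t0 < t1" for t0 t1
    using seg_flux_graph[OF that, of p x 0] by simp
  have int: "set_integrable lborel {a..b} (\<lambda>t. p (x, t))" for a b
    by (intro set_integrable_Icc_bipoly assms continuous_intros)
  have "{t..t + 2 * h} = {t..t + h} \<union> {t + h..t + 2 * h}" using assms(2) by auto
  moreover have "AE s in lborel. \<not> (s \<in> {t..t + h} \<and> s \<in> {t + h..t + 2 * h})"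
    using AE_lborel_singleton[of "t + h"] by (auto elim!: eventually_mono)
  ultimately have "(LINT t:{t..t + 2 * h}|lborel. p (x, t)) =
      (LINT t:{t..t + h}|lborel. p (x, t)) + (LINT t:{t + h..t + 2 * h}|lborel. p (x, t))"
    by (simp add: set_integral_Un_AE int)
  then show ?thesis using assms(2) by (simp add: flux)
qed

lemma transport_integral_control_volume:
  assumes p: "p \<in> bipoly" and pos: "\<Delta>x > 0" "\<Delta>t > 0" "\<delta> > 0" "\<delta> < 1"
  shows "(LINT z:control_volume \<Delta>x \<Delta>t \<delta> n i|lborel. transport p z) =
    (LINT x:{xleft \<Delta>x i..xright \<Delta>x i}|lborel. p (x, tlev \<Delta>t (Suc n)))
    - (LINT x:{xleft \<Delta>x i..xright \<Delta>x i}|lborel. p (x, tlev \<Delta>t n))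
    + face_flux p (cv_face_left \<Delta>x \<Delta>t \<delta> n i) + face_flux p (cv_face_right \<Delta>x \<Delta>t \<delta> n i)"
proof -
  define h where "h = \<Delta>t / 2"
  let ?x = "xleft \<Delta>x i" and ?y = "xright \<Delta>x i" and ?t = "tlev \<Delta>t n"
  let ?d = "\<delta> * \<Delta>x"
  have h: "h > 0" and d: "?d > 0" using pos by (auto simp: h_def)
  have y: "?y = ?x + \<Delta>x" "xleft \<Delta>x (Suc i) = ?y"
    by (simp_all add: xleft_def xright_def algebra_simps)
  \<comment> \<open>The sliver's tip stays inside the element, so the abscissae of the hexagon at
    the half level are ordered.\<close>
  have d': "?d \<le> \<Delta>x" using pos by (simp add: mult_le_cancel_right1)
  have geom: "tlev \<Delta>t (Suc n) = ?t + 2 * h"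
    "sliver \<Delta>x \<Delta>t \<delta> n j = diamond (xleft \<Delta>x j) ?t ?d h" for j
    by (simp_all add: tlev_Suc sliver_eq_diamond[OF pos(1-3)] h_def)
  note meas = borel_measurable_bipoly[OF bipoly_transport[OF p]]
  note faces = face_flux_def cv_face_left_def cv_face_right_def
    reverse_face_def sliver_face_left_def sliver_face_right_def
    sliver_bot_def sliver_right_def sliver_top_def sliver_left_def
  show ?thesis
  proof (cases "even i")
    case True
    then have le: "?x + ?d \<le> ?y" using d' by (simp add: y)
    have "(LINT z:control_volume \<Delta>x \<Delta>t \<delta> n i|lborel. transport p z) =
        (LINT z:hexagon ?x (?x + ?d) ?x ?y ?y ?y ?t h|lborel. transport p z)"
      using True set_integral_closure_cong[OF AE_rect_diff_diamond_right(1)[OF h d le]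
        compact_hexagon[OF h] AE_rect_diff_diamond_right(2)[OF h d le] meas]
      by (simp add: control_volume_def sliver_index_def geom)
    then show ?thesis
      using le d pos True unfolding faces geom
      by (simp add: transport_integral_hexagon[OF p h] seg_flux_vertical_split[OF p h] flip: h_def)
  next
    case False
    have le: "?x \<le> ?y - ?d" using d' by (simp add: y)
    have "(LINT z:control_volume \<Delta>x \<Delta>t \<delta> n i|lborel. transport p z) =
        (LINT z:hexagon ?x ?x ?x ?y (?y - ?d) ?y ?t h|lborel. transport p z)"
      using False set_integral_closure_cong[OF AE_rect_diff_diamond_left(1)[OF h d le]
        compact_hexagon[OF h] AE_rect_diff_diamond_left(2)[OF h d le] meas]
      by (simp add: control_volume_def sliver_index_def geom y(2))
    moreover have "seg_flux p (?x, ?t + 2 * h) (?x, ?t) =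
        seg_flux p (?x, ?t + 2 * h) (?x, ?t + h) + seg_flux p (?x, ?t + h) (?x, ?t)"
      using seg_flux_vertical_split[OF p h, of ?x ?t]
      by (simp add: seg_flux_swap[of p "(?x, ?t + 2 * h)"] seg_flux_swap[of p "(?x, ?t + h)" "(?x, ?t)"])
    ultimately show ?thesis
      using le d pos False unfolding faces geom
      by (simp add: transport_integral_hexagon[OF p h] y(2) flip: h_def)
  qed
qed

section \<open>Energy balance of a cell and of a face\<close>

lemma Re_set_integral:
  assumes "set_integrable M A f"
  shows "Re (LINT x:A|M. f x) = (LINT x:A|M. Re (f x))"
  using integral_Re[of M "\<lambda>x. indicator A x *\<^sub>R f x"] assms
  by (simp add: set_lebesgue_integral_def set_integrable_def)

lemma cnj_mult_self: "cnj z * z = of_real ((cmod z)\<^sup>2)"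
  by (simp only: complex_norm_square mult.commute)

definition energy :: "real \<Rightarrow> real \<Rightarrow> (real \<Rightarrow> complex) \<Rightarrow> real" where
  "energy a b f = (LINT x:{a..b}|lborel. (cmod (f x))\<^sup>2)"

lemma set_integral_cnj_mult_self: "(LINT x:{a..b}|lborel. cnj (f x) * f x) = of_real (energy a b f)"
  unfolding energy_def cnj_mult_self by (rule set_integral_complex_of_real)

text \<open>Young's inequality, that is |f - g|^2 \<ge> 0 pointwise. The weights are equal so that
  the f part cancels the half energy from the divergence theorem.\<close>

lemma Re_integral_cnj_mult_le:
  assumes "continuous_on {a..b} f" "continuous_on {a..b} g"
  shows "Re (LINT x:{a..b}|lborel. cnj (f x) * g x) \<le> (energy a b f + energy a b g) / 2"
proof -
  have "Re (LINT x:{a..b}|lborel. cnj (f x) * g x) = (LINT x:{a..b}|lborel. Re (cnj (f x) * g x))"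
    by (intro Re_set_integral borel_integrable_atLeastAtMost' continuous_intros assms)
  also have "\<dots> \<le> (LINT x:{a..b}|lborel. (cmod (f x))\<^sup>2 / 2 + (cmod (g x))\<^sup>2 / 2)"
  proof (rule set_integral_mono)
    fix x
    have "0 \<le> (Re (f x) - Re (g x))\<^sup>2 + (Im (f x) - Im (g x))\<^sup>2" by simp
    then show "Re (cnj (f x) * g x) \<le> (cmod (f x))\<^sup>2 / 2 + (cmod (g x))\<^sup>2 / 2"
      unfolding cmod_power2 by (simp add: power2_diff field_simps)
  qed (intro borel_integrable_atLeastAtMost' continuous_intros assms; simp)+
  also have "\<dots> = (LINT x:{a..b}|lborel. (cmod (f x))\<^sup>2 / 2) + (LINT x:{a..b}|lborel. (cmod (g x))\<^sup>2 / 2)"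
    by (intro set_integral_add borel_integrable_atLeastAtMost' continuous_intros assms) auto
  finally show ?thesis
    by (simp add: energy_def)
qed

text \<open>Pythagoras: orthogonality is tested with p itself, and |g|^2 exceeds |p|^2 + 2 Re ((g -
  p) \<open>cnj p\<close>) by |g - p|^2.\<close>

lemma energy_projection_le:
  assumes proj: "is_L2_projection N a b g p" and g: "continuous_on {a..b} g"
  shows "energy a b (\<lambda>x. poly p (of_real x)) \<le> energy a b g"
proof -
  let ?p = "\<lambda>x. poly p (complex_of_real x)"
  have p: "continuous_on {a..b} ?p" by (intro continuous_intros)
  have "(LINT x:{a..b}|lborel. (g x - ?p x) * cnj (?p x)) = 0"
    using proj by (auto simp: is_L2_projection_def)
  then have zero: "(LINT x:{a..b}|lborel. Re ((g x - ?p x) * cnj (?p x))) = 0"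
    by (subst Re_set_integral[symmetric])
      (auto intro!: borel_integrable_atLeastAtMost' continuous_intros g p)
  have "(LINT x:{a..b}|lborel. 2 * Re ((g x - ?p x) * cnj (?p x)) + (cmod (?p x))\<^sup>2) =
      (LINT x:{a..b}|lborel. 2 * Re ((g x - ?p x) * cnj (?p x))) + energy a b ?p"
    unfolding energy_def
    by (intro set_integral_add borel_integrable_atLeastAtMost' continuous_intros g p)
  then have "energy a b ?p = (LINT x:{a..b}|lborel. 2 * Re ((g x - ?p x) * cnj (?p x)) + (cmod (?p x))\<^sup>2)"
    by (simp only: set_integral_mult_right zero mult_zero_right add_0)
  also have "\<dots> \<le> energy a b g"
    unfolding energy_def
  proof (rule set_integral_mono)
    fix x
    have "0 \<le> (Re (g x) - Re (?p x))\<^sup>2 + (Im (g x) - Im (?p x))\<^sup>2" by simp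
    then show "2 * Re ((g x - ?p x) * cnj (?p x)) + (cmod (?p x))\<^sup>2 \<le> (cmod (g x))\<^sup>2"
      unfolding cmod_power2 by (simp add: power2_eq_square algebra_simps)
  qed (intro borel_integrable_atLeastAtMost' continuous_intros g p)+
  finally show ?thesis .
qed

text \<open>With w = \<open>transport (cnj q) * q\<close>, the product rule gives w +
  \<open>cnj w\<close> = 2 Re w for the transport of |q|^2.\<close>

lemma Re_transport_integral:
  assumes q: "q \<in> bipoly" and S: "compact S"
  shows "Re (LINT z:S|lborel. (partial_t (\<lambda>z. cnj (q z)) z + partial_x (\<lambda>z. cnj (q z)) z) * q z) =
    Re (LINT z:S|lborel. transport (\<lambda>z. cnj (q z) * q z) z) / 2"
proof -
  let ?w = "\<lambda>z. transport (\<lambda>z. cnj (q z)) z * q z"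
  have w: "?w \<in> bipoly"
    by (intro bipoly_mult bipoly_transport bipoly_cnj q)
  have "transport (\<lambda>z. cnj (q z) * q z) = (\<lambda>z. of_real (2 * Re (?w z)))"
  proof
    fix z
    have "transport (\<lambda>z. cnj (q z) * q z) z = ?w z + cnj (?w z)"
      by (simp add: transport_def partial_mult bipoly_cnj q partial_cnj algebra_simps)
    then show "transport (\<lambda>z. cnj (q z) * q z) z = of_real (2 * Re (?w z))"
      by (simp only: complex_add_cnj)
  qed
  then have "Re (LINT z:S|lborel. transport (\<lambda>z. cnj (q z) * q z) z) = 2 * (LINT z:S|lborel. Re (?w z))"
    by (simp only: set_integral_complex_of_real Re_complex_of_real set_integral_mult_right)
  then show ?thesis
    by (simp add: Re_set_integral[OF set_integrable_compact_bipoly[OF w S]] flip: transport_def)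
qed

text \<open>Off the horizontal n_x is nonzero, so the quotient in the grid velocity is genuine and
  s_max equals |n_x + n_t|. On a horizontal segment the convention x / 0 = 0 would make s_max vanish
  instead.\<close>

lemma rusanov_flux_seg_normal:
  assumes "snd a \<noteq> snd b"
  shows "of_real (dist a b) * rusanov_flux qm qp (seg_normal a b) =
    of_real (seg_weight a b) * (qp + qm) / 2 - of_real \<bar>seg_weight a b\<bar> * (qp - qm) / 2"
proof -
  define D where "D = dist a b"
  have D: "D > 0" using assms by (auto simp: D_def)
  define nx nt where "nx = (snd b - snd a) / D" and "nt = (fst a - fst b) / D"
  have n: "seg_normal a b = (nx, nt)"
    by (simp add: seg_normal_def nx_def nt_def D_def divide_inverse mult.commute)
  have "nx \<noteq> 0" using assms D by (simp add: nx_def)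
  then have "\<bar>1 - - nt / nx\<bar> * \<bar>nx\<bar> = \<bar>nx + nt\<bar>"
    by (simp flip: abs_mult add: field_simps)
  then have flux: "rusanov_flux qm qp (seg_normal a b) =
      of_real (nx + nt) * (qp + qm) / 2 - of_real \<bar>nx + nt\<bar> * (qp - qm) / 2"
    unfolding rusanov_flux_def n Let_def fst_conv snd_conv by (simp add: field_simps)
  have w: "seg_weight a b = D * (nx + nt)"
    using D by (simp add: seg_weight_def nx_def nt_def field_simps)
  then have "\<bar>seg_weight a b\<bar> = D * \<bar>nx + nt\<bar>"
    using D by (simp add: abs_mult)
  with w show ?thesis
    unfolding flux D_def[symmetric] by (simp add: field_simps)
qed

lemma seg_integral_rusanov:
  assumes "snd a \<noteq> snd b"
  shows "seg_integral a b (\<lambda>z. \<theta> z * rusanov_flux (f z) (g z) (seg_normal a b)) =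
    (LINT s:{0..1}|lborel. \<theta> (linepath a b s) *
      (of_real (seg_weight a b) * (g (linepath a b s) + f (linepath a b s)) / 2
       - of_real \<bar>seg_weight a b\<bar> * (g (linepath a b s) - f (linepath a b s)) / 2))"
  unfolding seg_integral_def scaleR_conv_of_real rusanov_flux_seg_normal[OF assms, symmetric]
  by (simp add: mult_ac flip: set_integral_mult_right)

text \<open>For one side of a face this has no sign, only the sum over the two sides has.\<close>

definition face_loss ::
    "(real \<times> real \<Rightarrow> complex) \<Rightarrow> (real \<times> real \<Rightarrow> complex) \<Rightarrow> face \<Rightarrow> real" where
  "face_loss qin qout F = Re (face_term (\<lambda>z. cnj (qin z)) qin qout F)
     - Re (face_flux (\<lambda>z. cnj (qin z) * qin z) F) / 2"

lemma face_loss_Nil [simp]: "face_loss f g [] = 0"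
  by (simp add: face_loss_def face_term_def face_flux_def)

lemma face_loss_append: "face_loss f g (F @ G) = face_loss f g F + face_loss f g G"
  by (simp add: face_loss_def face_term_def face_flux_def algebra_simps add_divide_distrib)

text \<open>Reversing the segment flips the sign of its weight M but not |M|. On each side
  \<open>face_flux\<close> removes the square of that side's own value from the central part; the
  mixed terms \<plusminus> M Re (\<open>cnj F * G\<close>) / 2 cancel between the sides, leaving |M|
  |F - G|^2 / 2.\<close>

lemma face_loss_segment_both_sides:
  assumes f: "continuous_on UNIV f" and g: "continuous_on UNIV g" and ab: "snd a \<noteq> snd b"
  shows "0 \<le> face_loss f g [(a, b)] + face_loss g f [(b, a)]"
proof -
  define M where "M = seg_weight a b"
  have M': "seg_weight b a = - M" by (simp add: M_def seg_weight_def)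
  define F G where "F = (\<lambda>s. f (linepath a b s))" and "G = (\<lambda>s. g (linepath a b s))"
  have cont: "continuous_on {0..1} F" "continuous_on {0..1} G"
    unfolding F_def G_def
    by (rule continuous_on_compose2[OF f] continuous_on_compose2[OF g];
        simp add: continuous_on_linepath)+
  note int = borel_integrable_atLeastAtMost'
  let ?A = "\<lambda>s. cnj (F s) * (of_real M * (G s + F s) / 2 - of_real \<bar>M\<bar> * (G s - F s) / 2)"
  let ?B = "\<lambda>s. cnj (G s) * (of_real (- M) * (F s + G s) / 2 - of_real \<bar>M\<bar> * (F s - G s) / 2)"
  let ?C = "\<lambda>s. of_real M * (cnj (F s) * F s) / 2"
  let ?D = "\<lambda>s. of_real M * (cnj (G s) * G s) / 2"
  have A: "seg_integral a b (\<lambda>z. cnj (f z) * rusanov_flux (f z) (g z) (seg_normal a b)) = (LINT s:{0..1}|lborel. ?A s)"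
    by (simp add: seg_integral_rusanov[OF ab] M_def F_def G_def)
  \<comment> \<open>The reflection s \<mapsto> 1 - s puts the reversed segment on the
    parametrisation used in \<open>A\<close>, so that the integrands can be added pointwise.\<close>
  have B: "seg_integral b a (\<lambda>z. cnj (g z) * rusanov_flux (g z) (f z) (seg_normal b a)) = (LINT s:{0..1}|lborel. ?B s)"
    using set_integral_Icc_reflect[of ?B]
    by (simp add: seg_integral_rusanov[OF ab[symmetric]] M' linepath_reflect[of b a] F_def G_def)
  have C: "seg_flux (\<lambda>z. cnj (f z) * f z) a b / 2 = (LINT s:{0..1}|lborel. ?C s)"
    by (simp add: seg_flux_def M_def F_def)
  have D: "seg_flux (\<lambda>z. cnj (g z) * g z) b a / 2 = - (LINT s:{0..1}|lborel. ?D s)"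
    by (simp add: seg_flux_swap[of "\<lambda>z. cnj (g z) * g z" b a]) (simp add: seg_flux_def M_def G_def)
  have "face_loss f g [(a, b)] + face_loss g f [(b, a)] =
      Re ((LINT s:{0..1}|lborel. ?A s) + (LINT s:{0..1}|lborel. ?B s)
        - (LINT s:{0..1}|lborel. ?C s) + (LINT s:{0..1}|lborel. ?D s))"
    using arg_cong[OF C, of Re] arg_cong[OF D, of Re]
    by (simp add: face_loss_def face_term_def face_flux_def A B)
  also have "(LINT s:{0..1}|lborel. ?A s) + (LINT s:{0..1}|lborel. ?B s)
        - (LINT s:{0..1}|lborel. ?C s) + (LINT s:{0..1}|lborel. ?D s) =
      (LINT s:{0..1}|lborel. ?A s + ?B s - ?C s + ?D s)"
  proof -
    have i: "set_integrable lborel {0..1} ?A" "set_integrable lborel {0..1} ?B"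
      "set_integrable lborel {0..1} ?C" "set_integrable lborel {0..1} ?D"
      by (intro int continuous_intros cont; simp)+
    show ?thesis
      using i by (simp only: set_integral_add set_integral_diff)
  qed
  also have "Re (LINT s:{0..1}|lborel. ?A s + ?B s - ?C s + ?D s) =
      (LINT s:{0..1}|lborel. Re (?A s + ?B s - ?C s + ?D s))"
    by (intro Re_set_integral int continuous_intros cont) auto
  also have "\<dots> \<ge> 0"
  proof -
    have "0 \<le> Re (?A s + ?B s - ?C s + ?D s)" for s
    proof -
      have "Re (?A s + ?B s - ?C s + ?D s) = \<bar>M\<bar> / 2 * ((Re (F s) - Re (G s))\<^sup>2 + (Im (F s) - Im (G s))\<^sup>2)"
        by (simp add: power2_eq_square field_simps)
      moreover have "0 \<le> \<bar>M\<bar> / 2 * ((Re (F s) - Re (G s))\<^sup>2 + (Im (F s) - Im (G s))\<^sup>2)"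
        by simp
      ultimately show ?thesis by (simp only:)
    qed
    then show ?thesis
      unfolding set_lebesgue_integral_def
      by (intro Bochner_Integration.integral_nonneg scaleR_nonneg_nonneg indicator_pos_le)
  qed
  finally show ?thesis .
qed

lemma reverse_face_Cons: "reverse_face ((a, b) # F) = reverse_face F @ [(b, a)]"
  by (simp add: reverse_face_def)

lemma face_loss_both_sides:
  assumes "continuous_on UNIV f" "continuous_on UNIV g" "\<And>a b. (a, b) \<in> set F \<Longrightarrow> snd a \<noteq> snd b"
  shows "0 \<le> face_loss f g F + face_loss g f (reverse_face F)"
  using assms(3)
proof (induction F)
  case Nil
  then show ?case by (simp add: reverse_face_def)
next
  case (Cons e F)
  obtain a b where e: "e = (a, b)" by (cases e)
  have "face_loss f g (e # F) = face_loss f g [(a, b)] + face_loss f g F"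
    using face_loss_append[of f g "[e]" F] by (simp add: e)
  moreover have "0 \<le> face_loss f g [(a, b)] + face_loss g f [(b, a)]"
    using Cons.prems e by (intro face_loss_segment_both_sides assms(1,2)) auto
  ultimately show ?case
    using Cons by (simp add: e reverse_face_Cons face_loss_append)
qed

text \<open>Needed for periodicity: it moves the loss of the last element from x = 2 pi to the face
  of element 1 at x = 0.\<close>

lemma face_loss_translate:
  "face_loss (\<lambda>(x, t). f (x + c, t)) (\<lambda>(x, t). g (x + c, t)) [((x0, t0), (x1, t1))] =
    face_loss f g [((x0 + c, t0), (x1 + c, t1))]"
proof -
  have lp: "linepath (x0 + c, t0) (x1 + c, t1) s =
      (fst (linepath (x0, t0) (x1, t1) s) + c, snd (linepath (x0, t0) (x1, t1) s))" for s
    by (simp add: linepath_def algebra_simps)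
  have "seg_normal (x0 + c, t0) (x1 + c, t1) = seg_normal (x0, t0) (x1, t1)"
    "dist (x0 + c, t0) (x1 + c, t1) = dist (x0, t0) (x1, t1)"
    "seg_weight (x0 + c, t0) (x1 + c, t1) = seg_weight (x0, t0) (x1, t1)"
    by (simp_all add: seg_normal_def seg_weight_def dist_Pair_Pair dist_real_def)
  then show ?thesis
    by (simp add: face_loss_def face_term_def face_flux_def seg_integral_def seg_flux_def lp split_def)
qed

section \<open>Energy balance of control volumes and slivers\<close>

lemma compact_control_volume: "compact (control_volume \<Delta>x \<Delta>t \<delta> n i)"
  unfolding control_volume_def compact_closure
  by (rule bounded_subset[OF bounded_Times[OF bounded_closed_interval bounded_closed_interval] Diff_subset])

lemma compact_sliver: "compact (sliver \<Delta>x \<Delta>t \<delta> n i)"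
  unfolding sliver_def by (intro compact_convex_hull finite_imp_compact) simp

lemma control_volume_energy:
  assumes q: "q i \<in> poly_space N" and eq: "control_volume_eq N Ne \<Delta>t \<delta> n U q qs i"
    and pos: "Ne > 0" "\<Delta>t > 0" "0 < \<delta>" "\<delta> < 1"
  defines "\<Delta>x \<equiv> mesh Ne"
  shows "energy (xleft \<Delta>x i) (xright \<Delta>x i) (\<lambda>x. q i (x, tlev \<Delta>t (Suc n)))
    + 2 * (face_loss (q i) (left_neighbour Ne q qs i) (cv_face_left \<Delta>x \<Delta>t \<delta> n i)
         + face_loss (q i) (right_neighbour Ne q qs i) (cv_face_right \<Delta>x \<Delta>t \<delta> n i))
    \<le> energy (xleft \<Delta>x i) (xright \<Delta>x i) (\<lambda>x. poly (U i) (of_real x))"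
proof -
  have b: "q i \<in> bipoly" using q by (rule poly_space_imp_bipoly)
  have dx: "\<Delta>x > 0" using pos by (simp add: \<Delta>x_def mesh_def)
  let ?a = "xleft \<Delta>x i" and ?b = "xright \<Delta>x i"
  let ?CV = "control_volume \<Delta>x \<Delta>t \<delta> n i"
  let ?q2 = "\<lambda>z. cnj (q i z) * q i z"
  have cont: "continuous_on {?a..?b} (\<lambda>x. q i (x, tlev \<Delta>t n))"
    by (intro continuous_on_bipoly[OF b] continuous_intros)
  have "Re (LINT z:?CV|lborel. transport ?q2 z) =
      energy ?a ?b (\<lambda>x. q i (x, tlev \<Delta>t (Suc n))) - energy ?a ?b (\<lambda>x. q i (x, tlev \<Delta>t n))
      + Re (face_flux ?q2 (cv_face_left \<Delta>x \<Delta>t \<delta> n i)) + Re (face_flux ?q2 (cv_face_right \<Delta>x \<Delta>t \<delta> n i))"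
    using transport_integral_control_volume[OF bipoly_mult[OF bipoly_cnj[OF b] b] dx pos(2-4)]
    by (simp add: set_integral_cnj_mult_self)
  moreover have "Re (LINT x:{?a..?b}|lborel. cnj (q i (x, tlev \<Delta>t n)) * poly (U i) (of_real x)) \<le>
      (energy ?a ?b (\<lambda>x. q i (x, tlev \<Delta>t n)) + energy ?a ?b (\<lambda>x. poly (U i) (of_real x))) / 2"
    by (intro Re_integral_cnj_mult_le cont continuous_intros)
  moreover note Re_transport_integral[OF b compact_control_volume[of \<Delta>x \<Delta>t \<delta> n i]]
  moreover have "Re ((LINT x:{?a..?b}|lborel. cnj (q i (x, tlev \<Delta>t (Suc n))) * q i (x, tlev \<Delta>t (Suc n)))
        - (LINT p:?CV|lborel. (partial_t (\<lambda>z. cnj (q i z)) p + partial_x (\<lambda>z. cnj (q i z)) p) * q i p)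
        + face_term (\<lambda>z. cnj (q i z)) (q i) (left_neighbour Ne q qs i) (cv_face_left \<Delta>x \<Delta>t \<delta> n i)
        + face_term (\<lambda>z. cnj (q i z)) (q i) (right_neighbour Ne q qs i) (cv_face_right \<Delta>x \<Delta>t \<delta> n i))
      = Re (LINT x:{?a..?b}|lborel. cnj (q i (x, tlev \<Delta>t n)) * poly (U i) (of_real x))"
    unfolding \<Delta>x_def
    by (rule arg_cong[where f = Re, OF bspec[OF eq[unfolded control_volume_eq_def Let_def] poly_space_cnj[OF q]]])
  \<comment> \<open>T and B are the energies of q at the new and old level, E is that of the data,
    and W the mixed old-level term. V is the area integral for |q|^2, V' the one in the scheme.
    Eliminating V and W cancels B.\<close>
  moreover have "T + 2 * (TL - FL / 2 + (TR - FR / 2)) \<le> E"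
    if "V = T - B + FL + FR" "W \<le> (B + E) / 2" "V' = V / 2" "T - V' + TL + TR = W"
    for T TL FL TR FR E V V' W B :: real
    using that by argo
  ultimately show ?thesis
    unfolding face_loss_def by (simp only: set_integral_cnj_mult_self plus_complex.sel minus_complex.sel Re_complex_of_real)
qed

lemma sliver_energy:
  assumes q: "qs i \<in> poly_space N" and eq: "sliver_eq N Ne \<Delta>t \<delta> n q qs i"
    and pos: "Ne > 0" "\<Delta>t > 0" "0 < \<delta>"
  defines "\<Delta>x \<equiv> mesh Ne"
  shows "face_loss (qs i) (q (i - 1)) (sliver_face_left \<Delta>x \<Delta>t \<delta> n i)
    + face_loss (qs i) (q i) (sliver_face_right \<Delta>x \<Delta>t \<delta> n i) = 0"
proof -
  have b: "qs i \<in> bipoly" using q by (rule poly_space_imp_bipoly)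
  have dx: "\<Delta>x > 0" using pos by (simp add: \<Delta>x_def mesh_def)
  have "Re (face_term (\<lambda>z. cnj (qs i z)) (qs i) (q (i - 1)) (sliver_face_left \<Delta>x \<Delta>t \<delta> n i)
      + face_term (\<lambda>z. cnj (qs i z)) (qs i) (q i) (sliver_face_right \<Delta>x \<Delta>t \<delta> n i)) =
      Re (LINT p:sliver \<Delta>x \<Delta>t \<delta> n i|lborel.
        (partial_t (\<lambda>z. cnj (qs i z)) p + partial_x (\<lambda>z. cnj (qs i z)) p) * qs i p)"
    unfolding \<Delta>x_def
    by (rule arg_cong[where f = Re, OF bspec[OF eq[unfolded sliver_eq_def Let_def] poly_space_cnj[OF q]]])
  then show ?thesis
    using Re_transport_integral[OF b compact_sliver[of \<Delta>x \<Delta>t \<delta> n i]]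
      transport_integral_sliver[OF bipoly_mult[OF bipoly_cnj[OF b] b] dx pos(2,3), of n i]
    by (simp add: face_loss_def)
qed

text \<open>Sliver 2k + 2 lies between elements 2k + 1 and 2k + 2. Since its own two losses cancel,
  they can be added for free, and every element loss then has its partner from the opposite side of
  the face.\<close>

lemma sum_losses_nonneg:
  fixes DL DR SL SR :: "nat \<Rightarrow> real"
  assumes S: "\<And>k. k < m \<Longrightarrow> SL (2 * k + 2) + SR (2 * k + 2) = 0"
    and L: "\<And>k. k < m \<Longrightarrow> 0 \<le> SL (2 * k + 2) + DR (2 * k + 1)"
    and R: "\<And>k. k < m \<Longrightarrow> 0 \<le> SR (2 * k + 2) + DL (2 * k + 2)"
    and V: "\<And>k. 0 < k \<Longrightarrow> k < m \<Longrightarrow> 0 \<le> DR (2 * k) + DL (2 * k + 1)"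
    and per: "0 \<le> DR (2 * m) + DL 1" and "0 < m"
  shows "0 \<le> (\<Sum>i=1..2 * m. DL i + DR i)"
proof -
  \<comment> \<open>The two outermost losses stay unpaired during the induction; \<open>per\<close>
    pairs them at the end.\<close>
  have "DL 1 + DR (2 * k) \<le> (\<Sum>i=1..2 * k. DL i + DR i)" if "0 < k" "k \<le> m" for k
    using that
  proof (induction k rule: nat_induct_non_zero)
    case 1
    with S[of 0] L[of 0] R[of 0] show ?case by (simp add: numeral_2_eq_2)
  next
    case (Suc k)
    with S[of k] L[of k] R[of k] V[of k] show ?case by simp
  qed
  from this[of m] per \<open>0 < m\<close> show ?thesis by simp
qed

section \<open>Energy decay\<close>

lemma tlev_mono: "\<Delta>t > 0 \<Longrightarrow> tlev \<Delta>t n < tlev \<Delta>t (Suc n)"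
  by (simp add: tlev_def algebra_simps)

lemma sliver_faces_not_horizontal:
  assumes "\<Delta>t > 0"
  shows "(a, b) \<in> set (sliver_face_left \<Delta>x \<Delta>t \<delta> n i) \<Longrightarrow> snd a \<noteq> snd b"
    and "(a, b) \<in> set (sliver_face_right \<Delta>x \<Delta>t \<delta> n i) \<Longrightarrow> snd a \<noteq> snd b"
  using assms
  by (auto simp: sliver_face_left_def sliver_face_right_def sliver_bot_def sliver_right_def
      sliver_top_def sliver_left_def tlev_Suc)

lemma ader_dg_step_energy:
  assumes step: "ader_dg_step N Ne \<Delta>t \<delta> n U U'"
    and pos: "Ne > 0" "even Ne" "\<Delta>t > 0" "0 < \<delta>" "\<delta> < 1"
  defines "\<Delta>x \<equiv> mesh Ne"
  shows "(\<Sum>i=1..Ne. energy (xleft \<Delta>x i) (xright \<Delta>x i) (\<lambda>x. poly (U' i) (of_real x)))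
    \<le> (\<Sum>i=1..Ne. energy (xleft \<Delta>x i) (xright \<Delta>x i) (\<lambda>x. poly (U i) (of_real x)))"
proof -
  from step obtain q qs where
    cells: "\<forall>i\<in>{1..Ne}. q i \<in> poly_space N \<and> control_volume_eq N Ne \<Delta>t \<delta> n U q qs i" and
    slivers: "\<forall>i\<in>{1..Ne}. even i \<longrightarrow> qs i \<in> poly_space N \<and> sliver_eq N Ne \<Delta>t \<delta> n q qs i" and
    projs: "\<forall>i\<in>{1..Ne}. is_L2_projection N (xleft (mesh Ne) i) (xright (mesh Ne) i)
      (\<lambda>x. q i (x, tlev \<Delta>t (Suc n))) (U' i)"
    unfolding ader_dg_step_def by (elim exE conjE) (rule that)
  note q = cells[THEN bspec, THEN conjunct1] cells[THEN bspec, THEN conjunct2]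
  note qs = slivers[THEN bspec, THEN mp, THEN conjunct1] slivers[THEN bspec, THEN mp, THEN conjunct2]
  note proj = projs[THEN bspec, folded \<Delta>x_def]
  obtain m where m: "Ne = 2 * m" using pos by (auto elim: evenE)
  have cont: "continuous_on UNIV (q i)" if "i \<in> {1..Ne}" for i
    using continuous_on_bipoly[OF poly_space_imp_bipoly[OF q(1)[OF that]] continuous_on_id] by simp
  have cont_s: "continuous_on UNIV (qs i)" if "i \<in> {1..Ne}" "even i" for i
    using continuous_on_bipoly[OF poly_space_imp_bipoly[OF qs(1)[OF that]] continuous_on_id] by simp
  define DL where "DL i = face_loss (q i) (left_neighbour Ne q qs i) (cv_face_left \<Delta>x \<Delta>t \<delta> n i)" for i
  define DR where "DR i = face_loss (q i) (right_neighbour Ne q qs i) (cv_face_right \<Delta>x \<Delta>t \<delta> n i)" for i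
  define SL where "SL i = face_loss (qs i) (q (i - 1)) (sliver_face_left \<Delta>x \<Delta>t \<delta> n i)" for i
  define SR where "SR i = face_loss (qs i) (q i) (sliver_face_right \<Delta>x \<Delta>t \<delta> n i)" for i
  have cell: "energy (xleft \<Delta>x i) (xright \<Delta>x i) (\<lambda>x. poly (U' i) (of_real x)) + 2 * (DL i + DR i)
      \<le> energy (xleft \<Delta>x i) (xright \<Delta>x i) (\<lambda>x. poly (U i) (of_real x))" if i: "i \<in> {1..Ne}" for i
  proof -
    have "energy (xleft \<Delta>x i) (xright \<Delta>x i) (\<lambda>x. poly (U' i) (of_real x)) \<le>
        energy (xleft \<Delta>x i) (xright \<Delta>x i) (\<lambda>x. q i (x, tlev \<Delta>t (Suc n)))"
      by (intro energy_projection_le[OF proj[OF i]] continuous_on_bipoly[OF poly_space_imp_bipoly[OF q(1)[OF i]]]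
          continuous_intros)
    then show ?thesis
      using control_volume_energy[OF q(1)[OF i] q(2)[OF i] pos(1,3-5)]
      by (simp add: DL_def DR_def \<Delta>x_def)
  qed
  note nonhor = sliver_faces_not_horizontal[OF pos(3)]
  have tn: "tlev \<Delta>t n \<noteq> tlev \<Delta>t (Suc n)"
    using tlev_mono[OF pos(3), of n] by simp
  have "0 \<le> (\<Sum>i=1..2 * m. DL i + DR i)"
  proof (rule sum_losses_nonneg)
    fix k assume "k < m"
    then have k: "2 * k + 2 \<in> {1..Ne}" "2 * k + 1 \<in> {1..Ne}" by (auto simp: m)
    show "SL (2 * k + 2) + SR (2 * k + 2) = 0"
      using sliver_energy[OF qs(1,2)[OF k(1)] pos(1,3,4)] by (simp add: SL_def SR_def \<Delta>x_def)
    show "0 \<le> SL (2 * k + 2) + DR (2 * k + 1)"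
      using face_loss_both_sides[OF cont_s[OF k(1)] cont[OF k(2)] nonhor(1)[where i = "2 * k + 2"]]
      by (simp add: SL_def DR_def right_neighbour_def cv_face_right_def)
    show "0 \<le> SR (2 * k + 2) + DL (2 * k + 2)"
      using face_loss_both_sides[OF cont_s[OF k(1)] cont[OF k(1)] nonhor(2)[where i = "2 * k + 2"]]
      by (simp add: SR_def DL_def left_neighbour_def cv_face_left_def)
  next
    fix k assume k: "0 < k" "k < m"
    then have k': "2 * k \<in> {1..Ne}" "2 * k + 1 \<in> {1..Ne}" by (auto simp: m)
    have "xleft \<Delta>x (2 * k + 1) = xright \<Delta>x (2 * k)" by (simp add: xleft_def xright_def)
    then show "0 \<le> DR (2 * k) + DL (2 * k + 1)"
      using face_loss_both_sides[OF cont[OF k'(1)] cont[OF k'(2)], of "cv_face_right \<Delta>x \<Delta>t \<delta> n (2 * k)"] k tn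
      by (simp add: DR_def DL_def left_neighbour_def right_neighbour_def cv_face_left_def cv_face_right_def
          reverse_face_def m)
  next
    have ends: "xleft \<Delta>x 1 = 0" "xright \<Delta>x Ne = 2 * pi"
      using pos by (simp_all add: xleft_def xright_def \<Delta>x_def mesh_def)
    have Ne: "Ne \<in> {1..Ne}" "1 \<in> {1..Ne}" using pos by auto
    \<comment> \<open>The approximant of the last element as seen from element 1 across the periodic
      boundary.\<close>
    let ?f = "\<lambda>(x, t). q Ne (x + 2 * pi, t)"
    have f: "continuous_on UNIV ?f"
      unfolding split_def
      by (intro continuous_on_bipoly[OF poly_space_imp_bipoly[OF q(1)[OF Ne(1)]]] continuous_intros)
    have "DR Ne = face_loss ?f (q 1) [((0, tlev \<Delta>t n), (0, tlev \<Delta>t (Suc n)))]"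
      using face_loss_translate[of "q Ne" "2 * pi" "\<lambda>(x, t). q 1 (x - 2 * pi, t)" 0 "tlev \<Delta>t n" 0 "tlev \<Delta>t (Suc n)"] pos
      by (simp add: DR_def right_neighbour_def cv_face_right_def ends)
    moreover have "DL 1 = face_loss (q 1) ?f (reverse_face [((0, tlev \<Delta>t n), (0, tlev \<Delta>t (Suc n)))])"
      by (simp add: DL_def left_neighbour_def cv_face_left_def ends[unfolded One_nat_def] reverse_face_def)
    ultimately show "0 \<le> DR (2 * m) + DL 1"
      using face_loss_both_sides[OF f cont[OF Ne(2)], of "[((0, tlev \<Delta>t n), (0, tlev \<Delta>t (Suc n)))]"] tn
      by (simp add: m)
    show "0 < m" using pos m by simp
  qed
  then have "0 \<le> 2 * (\<Sum>i=1..Ne. DL i + DR i)" by (simp add: m)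
  moreover have "(\<Sum>i=1..Ne. energy (xleft \<Delta>x i) (xright \<Delta>x i) (\<lambda>x. poly (U' i) (of_real x)) + 2 * (DL i + DR i))
    \<le> (\<Sum>i=1..Ne. energy (xleft \<Delta>x i) (xright \<Delta>x i) (\<lambda>x. poly (U i) (of_real x)))"
    by (intro sum_mono cell)
  ultimately show ?thesis
    unfolding sum.distrib sum_distrib_left[symmetric] by linarith
qed

text \<open>Intervals open on the left and closed on the right are exactly the level sets of the
  ceiling in \<open>discrete_fun\<close>, so they partition the domain; the changes of endpoints
  affect only null sets.\<close>

lemma L2_norm_on_discrete_fun:
  assumes "Ne > 0"
  defines "\<Delta>x \<equiv> mesh Ne"
  shows "L2_norm_on 0 (2 * pi) (discrete_fun \<Delta>x U) =
    sqrt (\<Sum>i=1..Ne. energy (xleft \<Delta>x i) (xright \<Delta>x i) (\<lambda>x. poly (U i) (of_real x)))"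
proof -
  have dx: "\<Delta>x > 0" using assms(1) by (simp add: \<Delta>x_def mesh_def)
  have len: "real Ne * \<Delta>x = 2 * pi" using assms(1) by (simp add: \<Delta>x_def mesh_def)
  define A where "A i = {xleft \<Delta>x i<..xright \<Delta>x i}" for i
  let ?f = "\<lambda>x. (cmod (discrete_fun \<Delta>x U x))\<^sup>2" and ?g = "\<lambda>i x. (cmod (poly (U i) (complex_of_real x)))\<^sup>2"
  have mem: "x \<in> A i \<longleftrightarrow> real i - 1 < x / \<Delta>x \<and> x / \<Delta>x \<le> real i" for x i
    using dx by (simp add: A_def xleft_def xright_def pos_less_divide_eq pos_divide_le_eq)
  have idx: "nat \<lceil>x / \<Delta>x\<rceil> = i" if "x \<in> A i" for x i
  proof -
    have "\<lceil>x / \<Delta>x\<rceil> = int i"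
      using that by (intro ceiling_unique) (auto simp: mem)
    then show ?thesis by simp
  qed
  have union: "(\<Union>i\<in>{1..Ne}. A i) = {0<..2 * pi}"
  proof (intro set_eqI iffI)
    fix x assume "x \<in> {0<..2 * pi}"
    then have x: "0 < x / \<Delta>x" "x / \<Delta>x \<le> real Ne"
      using dx len by (simp_all add: pos_divide_le_eq)
    define i where "i = nat \<lceil>x / \<Delta>x\<rceil>"
    have i: "real i = of_int \<lceil>x / \<Delta>x\<rceil>" using x by (simp add: i_def)
    have "x \<in> A i" unfolding mem i by linarith
    moreover have "i \<in> {1..Ne}"
      using x by (auto simp: i_def ceiling_le_iff le_nat_iff nat_le_iff one_le_ceiling)
    ultimately show "x \<in> (\<Union>i\<in>{1..Ne}. A i)" by blast
  next
    fix x assume "x \<in> (\<Union>i\<in>{1..Ne}. A i)"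
    then obtain i where i: "1 \<le> i" "i \<le> Ne" "x \<in> A i" by auto
    then have "0 < x / \<Delta>x" "x / \<Delta>x \<le> real Ne" by (auto simp: mem)
    then show "x \<in> {0<..2 * pi}"
      using dx len by (simp add: zero_less_divide_iff pos_divide_le_eq)
  qed
  have fg: "?f x = ?g i x" if "x \<in> A i" for x i
    using idx[OF that] by (simp add: discrete_fun_def)
  have int: "set_integrable lborel (A i) (?g i)" for i
  proof (rule set_integrable_subset)
    show "set_integrable lborel {xleft \<Delta>x i..xright \<Delta>x i} (?g i)"
      by (intro borel_integrable_atLeastAtMost' continuous_intros)
  qed (auto simp: A_def)
  have "(LINT x:{0<..<2 * pi}|lborel. ?f x) = (LINT x:(\<Union>i\<in>{1..Ne}. A i)|lborel. ?f x)"
    unfolding union by (rule set_integral_discrete_difference[of "{2 * pi}"]) auto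
  also have "\<dots> = (\<Sum>i=1..Ne. LINT x:A i|lborel. ?f x)"
  proof (rule set_integral_finite_Union)
    show "disjoint_family_on A {1..Ne}"
      using idx by (auto simp: disjoint_family_on_def)
    show "set_integrable lborel (A i) ?f" for i
      using int[of i] by (rule set_integrable_cong[THEN iffD1, rotated -1]) (auto simp: fg)
  qed (auto simp: A_def)
  also have "\<dots> = (\<Sum>i=1..Ne. energy (xleft \<Delta>x i) (xright \<Delta>x i) (\<lambda>x. poly (U i) (of_real x)))"
  proof (rule sum.cong[OF refl])
    fix i
    have "(LINT x:A i|lborel. ?f x) = (LINT x:A i|lborel. ?g i x)"
      by (rule set_lebesgue_integral_cong) (auto simp: fg A_def)
    also have "\<dots> = energy (xleft \<Delta>x i) (xright \<Delta>x i) (\<lambda>x. poly (U i) (of_real x))"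
      unfolding energy_def A_def
      by (rule set_integral_discrete_difference[of "{xleft \<Delta>x i}"]) auto
    finally show "(LINT x:A i|lborel. ?f x) = energy (xleft \<Delta>x i) (xright \<Delta>x i) (\<lambda>x. poly (U i) (of_real x))" .
  qed
  finally show ?thesis by (simp add: L2_norm_on_def)
qed

theorem theorem2:
  fixes N Ne \<kappa> :: nat and \<Delta>t \<delta> :: real and u :: "nat \<Rightarrow> nat \<Rightarrow> complex poly"
  assumes "N \<ge> 1" and "Ne > 0" and "even Ne"
    and "\<Delta>t > 0" and "0 < \<delta>" and "\<delta> < 1"
    and "\<delta> \<le> 1 / 2 * min (\<Delta>t / mesh Ne) 1"
    and "ader_dg_solution N Ne \<Delta>t \<delta> (\<lambda>x. exp (\<i> * of_nat \<kappa> * of_real x)) u"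
  shows "\<forall>n. L2_norm_on 0 (2 * pi) (discrete_fun (mesh Ne) (u n))
           \<le> L2_norm_on 0 (2 * pi) (discrete_fun (mesh Ne) (u 0))"
proof
  fix n
  have step: "ader_dg_step N Ne \<Delta>t \<delta> n (u n) (u (Suc n))" for n
    using assms(8) by (simp add: ader_dg_solution_def)
  show "L2_norm_on 0 (2 * pi) (discrete_fun (mesh Ne) (u n))
      \<le> L2_norm_on 0 (2 * pi) (discrete_fun (mesh Ne) (u 0))"
  proof (induction n)
    case (Suc n)
    have "L2_norm_on 0 (2 * pi) (discrete_fun (mesh Ne) (u (Suc n)))
        \<le> L2_norm_on 0 (2 * pi) (discrete_fun (mesh Ne) (u n))"
      unfolding L2_norm_on_discrete_fun[OF assms(2)]
      by (intro real_sqrt_le_mono ader_dg_step_energy[OF step] assms(2-6))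
    with Suc show ?case by simp
  qed simp
qed

end
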